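(* (Quantum Folk Theorem.) For every entanglement parameter $\theta$ there exists an appropriate discount factor $\delta\in(0,1)$ such that any payoffs in the feasible and individually rational payoff set are in the set $V^\star$.
   Context: Quantum prisoner's dilemma (single round). $t>r>p>s\ge0$ are real payoff parameters and $\theta\in[0,\frac{\pi}{2}]$ is the entanglement parameter ($\theta=0$: no entanglement, $\theta=\frac{\pi}{2}$: maximal entanglement). $|C\rangle,|D\rangle$ are orthonormal basis states of a qubit, and $X,Y,Z$ are the Pauli matrices. Put $\mathcal{J}=\cos\frac{\theta}{2}+i\sin\frac{\theta}{2}\,(Y\otimes Y)$. If Alice plays the unitary $U_A$ and Bob plays $U_B$, the single-round game is in the state $|\psi\rangle=\mathcal{J}^\dagger(U_A\otimes U_B)\mathcal{J}|CC\rangle$ (first factor Alice, second Bob), and player $i$ receives $\$_i(U_A,U_B)=\langle\psi|\hat{\$}_i|\psi\rangle$, where $\hat{\$}_A=r|CC\rangle\langle CC|+p|DD\rangle\langle DD|+t|DC\rangle\langle DC|+s|CD\rangle\langle CD|$ and $\hat{\$}_B$ is obtained from $\hat{\$}_A$ by exchanging $t$ and $s$. Mixed quantum strategies. A mixed quantum strategy is a choice of one of $I,X,Y,Z$ with probabilities $(p_I,p_X,p_Y,p_Z)$; $\$_i(p^A,p^B)$ is the corresponding expected payoff of player $i$ when Alice uses $p^A$ and Bob uses $p^B$. Repeated game. The game is played for infinitely many rounds and evolves by $|\psi^{k+1}\rangle=\mathcal{J}^\dagger(U_A^k\otimes U_B^k)\mathcal{J}|\psi^k\rangle$, where $U_i^k$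 is the strategy of player $i$ in round $k$; the state is measured and reward evaluated every round, the payoff being $\$_i^k=\langle\psi^k|\hat{\$}_i|\psi^k\rangle$, and the total payoff of player $i$ is $\sum_k\delta^k\$_i^k$ with discount factor $\delta\in(0,1)$. Mini-max values (mixed strategies). $\underline{\nu_A}=\min_{p^B}\max_{p^A}\$_A(p^A,p^B)$, and symmetrically $\underline{\nu_B}=\min_{p^A}\max_{p^B}\$_B(p^A,p^B)$. Feasible set. Let $S=U(2)\times U(2)$ with Haar measure $\mu$, let $\$(a)=(\$_A(a),\$_B(a))$ for $a\in S$, and let $V=\{\nu\in\mathbb{R}^2:\nu=\int_S p(a)\$(a)\,d\mu(a),\ p(a)\ge0,\ \int_S p(a)\,d\mu(a)=1\}$ (here $p(\cdot)$ is a density, not the payoff parameter). Here $\nu$ is the profit per single round of the repeated game. The set $V^\star=\{\nu\in V:\nu_i>\underline{\nu_i},\ i=A,B\}$ is what is called the feasible and individually rational payoff set.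
   Formalization: Read as: payoffs in V* are Nash equilibrium per-round payoffs of the repeated game. One δ for all of V* fails (e.g. θ=π/2), so δ is uniform only over payoffs exceeding both mini-max values by a prescribed margin ε>0; each payoff in V* is then attained for some δ. *)

theory Defs
  imports "HOL-Probability.Probability"
begin

section \<open>Qubits\<close>

datatype move = C | D

instance move :: finite
proof
  have "(UNIV :: move set) = {C, D}" by (auto intro: move.exhaust)
  then show "finite (UNIV :: move set)" by (metis finite.emptyI finite.insertI)
qed

text \<open>The computational basis of one qubit is indexed by \<^typ>\<open>move\<close>, that of the two-qubit space
  by pairs (Alice, Bob).\<close>

type_synonym qubit_op = "complex^move^move"
type_synonym two_qubit = "complex^(move \<times> move)"
type_synonym two_qubit_op = "complex^(move \<times> move)^(move \<times> move)"

definition dagger :: "complex^'n^'m \<Rightarrow> complex^'m^'n" where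
  "dagger A = (\<chi> i j. cnj (A $ j $ i))"

definition U2 :: "qubit_op set" where
  "U2 = {U. dagger U ** U = mat 1 \<and> U ** dagger U = mat 1}"

definition pauli_X :: qubit_op where
  "pauli_X = (\<chi> i j. if i = j then 0 else 1)"

definition pauli_Y :: qubit_op where
  "pauli_Y = (\<chi> i j. if i = j then 0 else if i = C then - \<i> else \<i>)"

definition pauli_Z :: qubit_op where
  "pauli_Z = (\<chi> i j. if i \<noteq> j then 0 else if i = C then 1 else - 1)"

definition kron :: "qubit_op \<Rightarrow> qubit_op \<Rightarrow> two_qubit_op" (infixl "\<otimes>\<^sub>K" 75) where
  "A \<otimes>\<^sub>K B = (\<chi> i j. A $ fst i $ fst j * B $ snd i $ snd j)"

definition ket :: "move \<Rightarrow> move \<Rightarrow> two_qubit" where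
  "ket a b = axis (a, b) 1"

definition ketbra :: "two_qubit \<Rightarrow> two_qubit_op" where
  "ketbra v = (\<chi> i j. v $ i * cnj (v $ j))"

text \<open>\<open>expval M \<psi>\<close> is \<open>\<langle>\<psi>|M|\<psi>\<rangle>\<close>; it is real because only Hermitian \<open>M\<close> are used.\<close>

definition expval :: "two_qubit_op \<Rightarrow> two_qubit \<Rightarrow> real" where
  "expval M \<psi> = Re (\<Sum>i\<in>UNIV. cnj (\<psi> $ i) * (M *v \<psi>) $ i)"


section \<open>The single-round game\<close>

definition J :: "real \<Rightarrow> two_qubit_op" where
  "J \<theta> = mat (complex_of_real (cos (\<theta> / 2)))
          + mat (\<i> * complex_of_real (sin (\<theta> / 2))) ** (pauli_Y \<otimes>\<^sub>K pauli_Y)"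

definition evolve :: "real \<Rightarrow> qubit_op \<times> qubit_op \<Rightarrow> two_qubit \<Rightarrow> two_qubit" where
  "evolve \<theta> a \<psi> = (dagger (J \<theta>) ** (fst a \<otimes>\<^sub>K snd a) ** J \<theta>) *v \<psi>"

definition reward_A :: "real \<Rightarrow> real \<Rightarrow> real \<Rightarrow> real \<Rightarrow> two_qubit_op" where
  "reward_A t r p s =
     r *\<^sub>R ketbra (ket C C) + p *\<^sub>R ketbra (ket D D)
   + t *\<^sub>R ketbra (ket D C) + s *\<^sub>R ketbra (ket C D)"

definition reward_B :: "real \<Rightarrow> real \<Rightarrow> real \<Rightarrow> real \<Rightarrow> two_qubit_op" where
  "reward_B t r p s = reward_A s r p t"

text \<open>In the following, \<open>M\<close> stands for the reward operator of the player concerned.\<close>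

definition payoff :: "real \<Rightarrow> two_qubit_op \<Rightarrow> qubit_op \<times> qubit_op \<Rightarrow> real" where
  "payoff \<theta> M a = expval M (evolve \<theta> a (ket C C))"


section \<open>Mixed quantum strategies and mini-max values\<close>

definition mixed_strategies :: "qubit_op pmf set" where
  "mixed_strategies = {q. set_pmf q \<subseteq> {mat 1, pauli_X, pauli_Y, pauli_Z}}"

definition mixed_payoff :: "real \<Rightarrow> two_qubit_op \<Rightarrow> qubit_op pmf \<Rightarrow> qubit_op pmf \<Rightarrow> real" where
  "mixed_payoff \<theta> M pA pB = measure_pmf.expectation (pair_pmf pA pB) (payoff \<theta> M)"

text \<open>The extrema are attained: the mixed strategies form a compact simplex, on which
  the payoff is bilinear.\<close>

definition minimax_A :: "real \<Rightarrow> real \<Rightarrow> real \<Rightarrow> real \<Rightarrow> real \<Rightarrow> real" where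
  "minimax_A t r p s \<theta> =
     (INF pB\<in>mixed_strategies. SUP pA\<in>mixed_strategies. mixed_payoff \<theta> (reward_A t r p s) pA pB)"

definition minimax_B :: "real \<Rightarrow> real \<Rightarrow> real \<Rightarrow> real \<Rightarrow> real \<Rightarrow> real" where
  "minimax_B t r p s \<theta> =
     (INF pA\<in>mixed_strategies. SUP pB\<in>mixed_strategies. mixed_payoff \<theta> (reward_B t r p s) pA pB)"


section \<open>Feasible and individually rational payoffs\<close>

abbreviation U2U2 :: "(qubit_op \<times> qubit_op) set" where
  "U2U2 \<equiv> U2 \<times> U2"

text \<open>The Haar measure on \<^term>\<open>U2U2\<close>, normalised to total mass 1. The group is compact,
  so left invariance determines it uniquely.\<close>

definition haar_prob :: "(qubit_op \<times> qubit_op) measure \<Rightarrow> bool" where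
  "haar_prob \<mu> \<longleftrightarrow>
     space \<mu> = U2U2 \<and> sets \<mu> = sets (restrict_space borel U2U2) \<and> prob_space \<mu> \<and>
     (\<forall>V\<in>U2. \<forall>W\<in>U2. distr \<mu> \<mu> (\<lambda>a. (V ** fst a, W ** snd a)) = \<mu>)"

definition feasible ::
  "real \<Rightarrow> real \<Rightarrow> real \<Rightarrow> real \<Rightarrow> real \<Rightarrow> (qubit_op \<times> qubit_op) measure \<Rightarrow> (real \<times> real) set" where
  "feasible t r p s \<theta> \<mu> =
     {\<nu>. \<exists>f. (\<forall>a\<in>U2U2. 0 \<le> f a) \<and> integrable \<mu> f \<and> (\<integral>a. f a \<partial>\<mu>) = 1 \<and>
          \<nu> = (\<integral>a. f a *\<^sub>R (payoff \<theta> (reward_A t r p s) a, payoff \<theta> (reward_B t r p s) a) \<partial>\<mu>)}"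

definition Vstar ::
  "real \<Rightarrow> real \<Rightarrow> real \<Rightarrow> real \<Rightarrow> real \<Rightarrow> (qubit_op \<times> qubit_op) measure \<Rightarrow> (real \<times> real) set" where
  "Vstar t r p s \<theta> \<mu> =
     {\<nu> \<in> feasible t r p s \<theta> \<mu>. fst \<nu> > minimax_A t r p s \<theta> \<and> snd \<nu> > minimax_B t r p s \<theta>}"


section \<open>The repeated game\<close>

text \<open>A history lists the action pairs played so far, the most recent one first. A strategy
  of the repeated game prescribes after each history a randomised choice of unitary (perfect
  monitoring, independent private randomisation, no correlating device).\<close>

type_synonym history = "(qubit_op \<times> qubit_op) list"
type_synonym rep_strategy = "history \<Rightarrow> qubit_op pmf"

definition rep_strategies :: "rep_strategy set" where
  "rep_strategies = {\<sigma>. \<forall>h. set_pmf (\<sigma> h) \<subseteq> U2}"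

text \<open>The state is not reset between rounds.\<close>

fun state :: "real \<Rightarrow> history \<Rightarrow> two_qubit" where
  "state \<theta> [] = ket C C"
| "state \<theta> (a # h) = evolve \<theta> a (state \<theta> h)"

fun play :: "rep_strategy \<Rightarrow> rep_strategy \<Rightarrow> nat \<Rightarrow> history pmf" where
  "play \<sigma> \<tau> 0 = return_pmf []"
| "play \<sigma> \<tau> (Suc k) =
     bind_pmf (play \<sigma> \<tau> k) (\<lambda>h. map_pmf (\<lambda>a. a # h) (pair_pmf (\<sigma> h) (\<tau> h)))"

definition stage_payoff ::
  "real \<Rightarrow> two_qubit_op \<Rightarrow> rep_strategy \<Rightarrow> rep_strategy \<Rightarrow> nat \<Rightarrow> real" where
  "stage_payoff \<theta> M \<sigma> \<tau> k = measure_pmf.expectation (play \<sigma> \<tau> k) (\<lambda>h. expval M (state \<theta> h))"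

text \<open>The state \<open>|\<psi>\<^sup>0\<rangle> = |CC\<rangle>\<close> precedes all play, so the first rewarded state is \<open>|\<psi>\<^sup>1\<rangle>\<close>.\<close>

definition total_payoff ::
  "real \<Rightarrow> real \<Rightarrow> two_qubit_op \<Rightarrow> rep_strategy \<Rightarrow> rep_strategy \<Rightarrow> real" where
  "total_payoff \<theta> \<delta> M \<sigma> \<tau> = (\<Sum>k. \<delta> ^ Suc k * stage_payoff \<theta> M \<sigma> \<tau> (Suc k))"

text \<open>The constant payoff per round that has the same discounted total.\<close>

definition profit_per_round ::
  "real \<Rightarrow> real \<Rightarrow> two_qubit_op \<Rightarrow> rep_strategy \<Rightarrow> rep_strategy \<Rightarrow> real" where
  "profit_per_round \<theta> \<delta> M \<sigma> \<tau> = total_payoff \<theta> \<delta> M \<sigma> \<tau> / (\<Sum>k. \<delta> ^ Suc k)"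

definition nash_equilibrium ::
  "real \<Rightarrow> real \<Rightarrow> real \<Rightarrow> real \<Rightarrow> real \<Rightarrow> real \<Rightarrow> rep_strategy \<Rightarrow> rep_strategy \<Rightarrow> bool" where
  "nash_equilibrium t r p s \<theta> \<delta> \<sigma> \<tau> \<longleftrightarrow>
     \<sigma> \<in> rep_strategies \<and> \<tau> \<in> rep_strategies \<and>
     (\<forall>\<sigma>'\<in>rep_strategies.
        total_payoff \<theta> \<delta> (reward_A t r p s) \<sigma>' \<tau> \<le> total_payoff \<theta> \<delta> (reward_A t r p s) \<sigma> \<tau>) \<and>
     (\<forall>\<tau>'\<in>rep_strategies.
        total_payoff \<theta> \<delta> (reward_B t r p s) \<sigma> \<tau>' \<le> total_payoff \<theta> \<delta> (reward_B t r p s) \<sigma> \<tau>)"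

definition equilibrium_payoffs ::
  "real \<Rightarrow> real \<Rightarrow> real \<Rightarrow> real \<Rightarrow> real \<Rightarrow> real \<Rightarrow> (real \<times> real) set" where
  "equilibrium_payoffs t r p s \<theta> \<delta> =
     {(profit_per_round \<theta> \<delta> (reward_A t r p s) \<sigma> \<tau>, profit_per_round \<theta> \<delta> (reward_B t r p s) \<sigma> \<tau>)
       | \<sigma> \<tau>. nash_equilibrium t r p s \<theta> \<delta> \<sigma> \<tau>}"

end

theory Submission
  imports Defs
begin

text \<open>Because the entangler is unitary, the state after several rounds depends only on the products of
  the actions played by each player, so the repeated quantum game is an ordinary repeated game in
  which every round is played afresh with action sets \<open>U(2)\<close>. Against a Pauli mixture a unitary earns
  a convex combination of what the Pauli matrices earn, so the punisher can hold any deviator down to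
  the mini-max value forever. Every feasible payoff is a mixture of the payoffs of two pure action
  pairs; a deterministic sequence alternating between them realises it exactly for a patient discount
  factor, with all continuation payoffs close to it. Grim trigger strategies then form an equilibrium.\<close>

section \<open>Two-qubit dynamics and outcome probabilities\<close>

text \<open>The players share no correlating device, so a feasible point has to come from a
  deterministic schedule, every tail of which stays above the punishment level. With only two action
  pairs the tail value is affine in a single frequency, which a one-dimensional greedy rule controls
  as soon as \<delta> \<ge> 1/2. Two pairs suffice because \<open>I\<close> and \<open>Y\<close>
  commute with the entangler: they reproduce the classical game for every \<theta>, and their
  superpositions are pure actions that sweep whole edges between classical profiles. Since the state
  is never reset, a randomising punisher must not be burdened by earlier draws. Past actions are
  observed, so each punishing action first undoes the punisher's own accumulated product. The margin
  \<epsilon> is fixed before \<delta>: a one-round gain of up to \<open>t\<close> has to be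
  outweighed by the later loss, and this argument asks for more patience as the distance to the
  mini-max value shrinks. The resulting \<delta> depends on \<epsilon> and \<open>t\<close> alone,
  hence works for all payoffs with that margin at once.\<close>

lemma UNIV_move: "(UNIV :: move set) = {C, D}"
  by (auto intro: move.exhaust)

lemma sum_move: "(\<Sum>i\<in>(UNIV :: move set). f i) = f C + (f D :: 'a :: comm_monoid_add)"
  by (simp add: UNIV_move)

lemma sum_move_pair:
  "(\<Sum>i\<in>(UNIV :: (move \<times> move) set). f i) = f (C, C) + f (C, D) + f (D, C) + (f (D, D) :: 'a :: comm_monoid_add)"
proof -
  have U: "(UNIV :: (move \<times> move) set) = {(C, C), (C, D), (D, C), (D, D)}"
    by (auto intro: move.exhaust)
  show ?thesis
    unfolding U by (simp add: add.assoc)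
qed

lemma all_move: "(\<forall>i. P i) \<longleftrightarrow> P C \<and> P D"
  by (metis move.exhaust)

lemma qubit_op_eq_iff:
  fixes A B :: qubit_op
  shows "A = B \<longleftrightarrow> A$C$C = B$C$C \<and> A$C$D = B$C$D \<and> A$D$C = B$D$C \<and> A$D$D = B$D$D"
  by (auto simp: vec_eq_iff all_move)

lemma dagger_nth: "dagger A $ i $ j = cnj (A $ j $ i)"
  by (simp add: dagger_def)

lemma dagger_mult: "dagger (A ** B) = dagger B ** dagger A"
  by (simp add: vec_eq_iff dagger_def matrix_matrix_mult_def mult.commute)

lemma dagger_dagger [simp]: "dagger (dagger A) = A"
  by (simp add: vec_eq_iff dagger_def)

lemma U2_one: "mat 1 \<in> U2"
  by (simp add: U2_def qubit_op_eq_iff matrix_matrix_mult_def sum_move dagger_nth mat_def)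

lemma U2_dagger: "U \<in> U2 \<Longrightarrow> dagger U \<in> U2"
  by (simp add: U2_def)

lemma U2_mult:
  assumes "U \<in> U2" "V \<in> U2"
  shows "U ** V \<in> U2"
proof -
  have "dagger V ** dagger U ** (U ** V) = dagger V ** (dagger U ** U) ** V"
       "U ** V ** (dagger V ** dagger U) = U ** (V ** dagger V) ** dagger U"
    by (simp_all add: matrix_mul_assoc)
  then show ?thesis using assms by (simp add: U2_def dagger_mult)
qed

abbreviation paulis :: "qubit_op set" where
  "paulis \<equiv> {mat 1, pauli_X, pauli_Y, pauli_Z}"

lemma U2_pauli: "paulis \<subseteq> U2"
  by (simp add: U2_def qubit_op_eq_iff matrix_matrix_mult_def sum_move dagger_nth mat_def
      pauli_X_def pauli_Y_def pauli_Z_def)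

lemma kron_mult: "(A \<otimes>\<^sub>K B) ** (A' \<otimes>\<^sub>K B') = (A ** A') \<otimes>\<^sub>K (B ** B')"
  by (simp add: vec_eq_iff kron_def matrix_matrix_mult_def sum_move_pair sum_move algebra_simps)

lemma dagger_kron: "dagger (A \<otimes>\<^sub>K B) = dagger A \<otimes>\<^sub>K dagger B"
  by (simp add: vec_eq_iff kron_def dagger_def)

lemma kron_one: "mat 1 \<otimes>\<^sub>K mat 1 = mat 1"
  by (auto simp: vec_eq_iff kron_def mat_def)

lemma J_nth:
  "J \<theta> $ (a, b) $ (a', b') =
     (if a = a' \<and> b = b' then complex_of_real (cos (\<theta> / 2))
      else if a \<noteq> a' \<and> b \<noteq> b' then (if a = b then - 1 else 1) * (\<i> * complex_of_real (sin (\<theta> / 2)))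
      else 0)"
  unfolding J_def
  by (cases a; cases b; cases a'; cases b')
     (simp_all add: matrix_matrix_mult_def sum_move_pair mat_def kron_def pauli_Y_def)

lemma of_real_sin_cos: "complex_of_real (cos x) * complex_of_real (cos x) + complex_of_real (sin x) * complex_of_real (sin x) = 1"
  by (simp only: of_real_mult[symmetric] of_real_add[symmetric] sin_cos_squared_add3 of_real_1)

lemma J_unitary: "dagger (J \<theta>) ** J \<theta> = mat 1" "J \<theta> ** dagger (J \<theta>) = mat 1"
  unfolding vec_eq_iff split_paired_All all_move
  using of_real_sin_cos[of "\<theta> / 2"]
  by (simp_all add: matrix_matrix_mult_def sum_move_pair mat_def dagger_nth J_nth algebra_simps)

lemma sum_cmod_isometry:
  fixes M :: "complex^'n^'m"
  assumes "dagger M ** M = mat 1"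
  shows "(\<Sum>i\<in>UNIV. (cmod ((M *v v) $ i))\<^sup>2) = (\<Sum>j\<in>UNIV. (cmod (v $ j))\<^sup>2)"
proof -
  have "complex_of_real (\<Sum>i\<in>UNIV. (cmod ((M *v v) $ i))\<^sup>2)
      = (\<Sum>i\<in>UNIV. (M *v v) $ i * cnj ((M *v v) $ i))"
    by (simp only: of_real_sum complex_norm_square)
  also have "\<dots> = (\<Sum>i\<in>UNIV. \<Sum>j\<in>UNIV. cnj (v $ j) * (cnj (M $ i $ j) * (M *v v) $ i))"
    by (simp add: matrix_vector_mult_def[of M v] sum_distrib_left sum_distrib_right mult_ac)
  also have "\<dots> = (\<Sum>j\<in>UNIV. cnj (v $ j) * (dagger M *v (M *v v)) $ j)"
    by (subst sum.swap) (simp add: matrix_vector_mult_def[of "dagger M"] dagger_nth sum_distrib_left)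
  also have "dagger M *v (M *v v) = v"
    by (simp add: matrix_vector_mul_assoc assms)
  also have "(\<Sum>j\<in>UNIV. cnj (v $ j) * v $ j) = complex_of_real (\<Sum>j\<in>UNIV. (cmod (v $ j))\<^sup>2)"
    by (simp only: of_real_sum complex_norm_square mult.commute)
  finally show ?thesis
    by (simp only: of_real_eq_iff)
qed

lemma evolve_compose: "evolve \<theta> a (evolve \<theta> b \<psi>) = evolve \<theta> (fst a ** fst b, snd a ** snd b) \<psi>"
proof -
  have "dagger (J \<theta>) ** (fst a \<otimes>\<^sub>K snd a) ** J \<theta> ** (dagger (J \<theta>) ** (fst b \<otimes>\<^sub>K snd b) ** J \<theta>)
     = dagger (J \<theta>) ** (fst a \<otimes>\<^sub>K snd a) ** (J \<theta> ** dagger (J \<theta>)) ** (fst b \<otimes>\<^sub>K snd b) ** J \<theta>"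
    by (simp only: matrix_mul_assoc)
  also have "\<dots> = dagger (J \<theta>) ** ((fst a \<otimes>\<^sub>K snd a) ** (fst b \<otimes>\<^sub>K snd b)) ** J \<theta>"
    by (simp add: J_unitary matrix_mul_assoc)
  finally show ?thesis
    by (simp add: evolve_def matrix_vector_mul_assoc kron_mult)
qed

lemma evolve_one: "evolve \<theta> (mat 1, mat 1) \<psi> = \<psi>"
  by (simp add: evolve_def kron_one J_unitary)

lemma norm_evolve:
  assumes "a \<in> U2U2"
  shows "(\<Sum>i\<in>UNIV. (cmod (evolve \<theta> a \<psi> $ i))\<^sup>2) = (\<Sum>i\<in>UNIV. (cmod (\<psi> $ i))\<^sup>2)"
proof -
  let ?K = "fst a \<otimes>\<^sub>K snd a"
  have K: "dagger ?K ** ?K = mat 1"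
    using assms by (auto simp: dagger_kron kron_mult U2_def kron_one)
  have "dagger (dagger (J \<theta>) ** ?K ** J \<theta>) ** (dagger (J \<theta>) ** ?K ** J \<theta>)
      = dagger (J \<theta>) ** dagger ?K ** (J \<theta> ** dagger (J \<theta>)) ** ?K ** J \<theta>"
    by (simp add: dagger_mult matrix_mul_assoc)
  also have "\<dots> = dagger (J \<theta>) ** (dagger ?K ** ?K) ** J \<theta>"
    by (simp add: J_unitary matrix_mul_assoc)
  also have "\<dots> = mat 1"
    by (simp add: K J_unitary)
  finally show ?thesis
    unfolding evolve_def by (rule sum_cmod_isometry)
qed

section \<open>Outcome probabilities of a single round\<close>

definition outcome_prob :: "real \<Rightarrow> qubit_op \<times> qubit_op \<Rightarrow> move \<times> move \<Rightarrow> real" where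
  "outcome_prob \<theta> a i = (cmod (evolve \<theta> a (ket C C) $ i))\<^sup>2"

lemma payoff_eq:
  "payoff \<theta> (reward_A t r p s) a =
     r * outcome_prob \<theta> a (C, C) + p * outcome_prob \<theta> a (D, D)
   + t * outcome_prob \<theta> a (D, C) + s * outcome_prob \<theta> a (C, D)"
proof -
  have "expval (reward_A t r p s) \<psi> =
      r * (cmod (\<psi> $ (C, C)))\<^sup>2 + p * (cmod (\<psi> $ (D, D)))\<^sup>2
    + t * (cmod (\<psi> $ (D, C)))\<^sup>2 + s * (cmod (\<psi> $ (C, D)))\<^sup>2" for \<psi>
    unfolding expval_def cmod_power2 unfolding power2_eq_square
    by (simp add: sum_move_pair matrix_vector_mult_def reward_A_def ketbra_def ket_def axis_def
        algebra_simps)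
  then show ?thesis by (simp add: payoff_def outcome_prob_def)
qed

lemma outcome_prob_sum:
  assumes "a \<in> U2U2"
  shows "outcome_prob \<theta> a (C, C) + outcome_prob \<theta> a (C, D)
       + outcome_prob \<theta> a (D, C) + outcome_prob \<theta> a (D, D) = 1"
  using norm_evolve[OF assms, of \<theta> "ket C C"]
  by (simp add: sum_move_pair outcome_prob_def ket_def axis_def)

lemma outcome_prob_nonneg [simp]: "0 \<le> outcome_prob \<theta> a i"
  by (simp add: outcome_prob_def)

lemma payoff_bounds:
  assumes "a \<in> U2U2" and "{t, r, p, s} \<subseteq> {0..m}"
  shows "0 \<le> payoff \<theta> (reward_A t r p s) a" and "payoff \<theta> (reward_A t r p s) a \<le> m"
proof -
  show "0 \<le> payoff \<theta> (reward_A t r p s) a"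
    using assms(2) by (simp add: payoff_eq)
  have "payoff \<theta> (reward_A t r p s) a \<le>
     m * outcome_prob \<theta> a (C, C) + m * outcome_prob \<theta> a (D, D)
   + m * outcome_prob \<theta> a (D, C) + m * outcome_prob \<theta> a (C, D)"
    unfolding payoff_eq using assms(2) by (intro add_mono mult_right_mono) auto
  also have "\<dots> = m * (outcome_prob \<theta> a (C, C) + outcome_prob \<theta> a (C, D)
       + outcome_prob \<theta> a (D, C) + outcome_prob \<theta> a (D, D))"
    by (simp add: algebra_simps)
  finally show "payoff \<theta> (reward_A t r p s) a \<le> m"
    by (simp add: outcome_prob_sum[OF assms(1)])
qed

text \<open>\<open>J\<close> turns the initial state into \<open>c\<close> times CC minus
  \<open>d\<close> times DD, and \<open>w\<close> is the amplitude after both moves. The adjoint of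
  \<open>J\<close> then mixes an outcome only with the one in which both letters are
  flipped.\<close>

lemma evolve_nth:
  defines "c \<equiv> (\<lambda>\<theta>. complex_of_real (cos (\<theta> / 2)))" and "d \<equiv> (\<lambda>\<theta>. \<i> * complex_of_real (sin (\<theta> / 2)))"
  defines "w \<equiv> (\<lambda>\<theta> U V i j. c \<theta> * (U $ i $ C * V $ j $ C) - d \<theta> * (U $ i $ D * V $ j $ D))"
  shows "evolve \<theta> (U, V) (ket C C) $ (C, C) = c \<theta> * w \<theta> U V C C + d \<theta> * w \<theta> U V D D"
    and "evolve \<theta> (U, V) (ket C C) $ (D, D) = c \<theta> * w \<theta> U V D D + d \<theta> * w \<theta> U V C C"
    and "evolve \<theta> (U, V) (ket C C) $ (C, D) = c \<theta> * w \<theta> U V C D - d \<theta> * w \<theta> U V D C"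
    and "evolve \<theta> (U, V) (ket C C) $ (D, C) = c \<theta> * w \<theta> U V D C - d \<theta> * w \<theta> U V C D"
  unfolding evolve_def c_def d_def w_def
  by (simp_all add: matrix_vector_mul_assoc[symmetric])
     (simp_all add: matrix_vector_mult_def sum_move_pair dagger_nth J_nth ket_def axis_def kron_def
      algebra_simps)

text \<open>\<open>J\<close> and the initial state are both invariant under exchanging the two
  qubits.\<close>

lemma outcome_prob_swap: "outcome_prob \<theta> (V, U) (i, j) = outcome_prob \<theta> (U, V) (j, i)"
  by (cases i; cases j) (simp_all add: outcome_prob_def evolve_nth mult.commute)

lemma payoff_swap: "payoff \<theta> (reward_A t r p s) (V, U) = payoff \<theta> (reward_A s r p t) (U, V)"
  by (simp add: payoff_eq outcome_prob_swap[of \<theta> V U])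

text \<open>The combination equals (x + y) S + (x - y) T with S, T half the sum and half the
  difference of u and v. Equal moduli make S times the conjugate of T purely imaginary, and the
  second hypothesis makes (x + y) times the conjugate of (x - y) real, so the interference term has
  real part zero.\<close>

lemma cmod_combination_pauli:
  fixes u v x y :: complex
  assumes "cmod u = cmod v" and "Im (x * cnj y) = 0"
  shows "(cmod (x * u + y * v))\<^sup>2
       = (cmod ((u + v) / 2))\<^sup>2 * (cmod (x + y))\<^sup>2 + (cmod ((u - v) / 2))\<^sup>2 * (cmod (x - y))\<^sup>2"
proof -
  let ?S = "(u + v) / 2" and ?T = "(u - v) / 2"
  have "(Re u)\<^sup>2 + (Im u)\<^sup>2 = (Re v)\<^sup>2 + (Im v)\<^sup>2"
    using assms(1) by (simp flip: cmod_power2)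
  then have S: "Re (?S * cnj ?T) = 0"
    by (simp add: power2_eq_square algebra_simps)
  have I: "Im ((x + y) * cnj (x - y)) = 0"
    using assms(2) by (simp add: algebra_simps)
  have "(x + y) * ?S * cnj ((x - y) * ?T) = ((x + y) * cnj (x - y)) * (?S * cnj ?T)"
    by (simp add: mult_ac)
  then have orth: "Re ((x + y) * ?S * cnj ((x - y) * ?T)) = 0"
    using S I by (simp only: times_complex.sel)
  have add: "(cmod (a + b))\<^sup>2 = (cmod a)\<^sup>2 + (cmod b)\<^sup>2 + 2 * Re (a * cnj b)" for a b
    unfolding cmod_power2 by (simp add: power2_eq_square algebra_simps)
  have "x * u + y * v = (x + y) * ?S + (x - y) * ?T"
    by (simp add: field_simps)
  then show ?thesis
    using orth add[of "(x + y) * ?S" "(x - y) * ?T"]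
    by (simp only: norm_mult power_mult_distrib mult.commute)
qed

text \<open>Compare the norm of the first column with the norms of the two rows.\<close>

lemma U2_cmod:
  assumes "U \<in> U2"
  shows "cmod (U $ C $ C) = cmod (U $ D $ D)" "cmod (U $ C $ D) = cmod (U $ D $ C)"
    "(cmod (U $ C $ C))\<^sup>2 + (cmod (U $ D $ C))\<^sup>2 = 1"
proof -
  have "dagger U ** U = mat 1" "U ** dagger U = mat 1"
    using assms by (simp_all add: U2_def)
  from arg_cong[OF this(1), of "\<lambda>M. M $ C $ C"] arg_cong[OF this(2), of "\<lambda>M. M $ C $ C"]
    arg_cong[OF this(2), of "\<lambda>M. M $ D $ D"]
  have "complex_of_real ((cmod (U $ C $ C))\<^sup>2 + (cmod (U $ D $ C))\<^sup>2) = 1"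
       "complex_of_real ((cmod (U $ C $ C))\<^sup>2 + (cmod (U $ C $ D))\<^sup>2) = 1"
       "complex_of_real ((cmod (U $ D $ C))\<^sup>2 + (cmod (U $ D $ D))\<^sup>2) = 1"
    unfolding of_real_add complex_norm_square
    by (simp_all add: matrix_matrix_mult_def sum_move dagger_nth mat_def mult.commute)
  then have "(cmod (U $ C $ C))\<^sup>2 + (cmod (U $ D $ C))\<^sup>2 = 1"
       "(cmod (U $ C $ C))\<^sup>2 + (cmod (U $ C $ D))\<^sup>2 = 1"
       "(cmod (U $ D $ C))\<^sup>2 + (cmod (U $ D $ D))\<^sup>2 = 1"
    by (simp_all only: of_real_eq_1_iff)
  moreover from this have "(cmod (U $ C $ C))\<^sup>2 = (cmod (U $ D $ D))\<^sup>2"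
      "(cmod (U $ C $ D))\<^sup>2 = (cmod (U $ D $ C))\<^sup>2"
    by linarith+
  ultimately show "cmod (U $ C $ C) = cmod (U $ D $ D)" "cmod (U $ C $ D) = cmod (U $ D $ C)"
    "(cmod (U $ C $ C))\<^sup>2 + (cmod (U $ D $ C))\<^sup>2 = 1"
    by simp_all
qed

text \<open>The squared modulus of the coefficient of \<open>U\<close> along \<open>P\<close>: the
  sum is the trace of \<open>dagger P ** U\<close>, and the Pauli matrices are orthonormal for half
  the trace inner product.\<close>

definition pauli_weight :: "qubit_op \<Rightarrow> qubit_op \<Rightarrow> real" where
  "pauli_weight U P = (cmod ((\<Sum>i\<in>UNIV. \<Sum>j\<in>UNIV. cnj (P $ i $ j) * U $ i $ j) / 2))\<^sup>2"

lemma pauli_nth: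
  "(mat 1 :: qubit_op) $ i $ j = (if i = j then 1 else 0)"
  "pauli_X $ i $ j = (if i = j then 0 else 1)"
  "pauli_Y $ i $ j = (if i = j then 0 else if i = C then - \<i> else \<i>)"
  "pauli_Z $ i $ j = (if i \<noteq> j then 0 else if i = C then 1 else - 1)"
  by (simp_all add: mat_def pauli_X_def pauli_Y_def pauli_Z_def)

lemma pauli_weight_eq:
  "pauli_weight U (mat 1) = (cmod ((U $ C $ C + U $ D $ D) / 2))\<^sup>2"
  "pauli_weight U pauli_X = (cmod ((U $ C $ D + U $ D $ C) / 2))\<^sup>2"
  "pauli_weight U pauli_Y = (cmod ((U $ C $ D - U $ D $ C) / 2))\<^sup>2"
  "pauli_weight U pauli_Z = (cmod ((U $ C $ C - U $ D $ D) / 2))\<^sup>2"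
proof -
  have "\<i> * U $ C $ D - \<i> * U $ D $ C = \<i> * (U $ C $ D - U $ D $ C)"
    by (simp add: algebra_simps)
  then show "pauli_weight U pauli_Y = (cmod ((U $ C $ D - U $ D $ C) / 2))\<^sup>2"
    by (simp add: pauli_weight_def sum_move pauli_nth norm_mult norm_divide)
qed (simp_all add: pauli_weight_def sum_move pauli_nth)

abbreviation pauli_sum :: "qubit_op \<Rightarrow> (qubit_op \<Rightarrow> real) \<Rightarrow> real" where
  "pauli_sum U f \<equiv> pauli_weight U (mat 1) * f (mat 1) + pauli_weight U pauli_X * f pauli_X
     + pauli_weight U pauli_Y * f pauli_Y + pauli_weight U pauli_Z * f pauli_Z"

text \<open>Parseval's identity, obtained from the parallelogram law on the diagonal and on the
  off-diagonal pair of entries.\<close>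

lemma pauli_weight_sum:
  assumes "U \<in> U2"
  shows "pauli_sum U (\<lambda>_. 1) = 1"
proof -
  have par: "(cmod ((u + v) / 2))\<^sup>2 + (cmod ((u - v) / 2))\<^sup>2 = ((cmod u)\<^sup>2 + (cmod v)\<^sup>2) / 2" for u v
    unfolding cmod_power2 by (simp add: power2_eq_square field_simps)
  show ?thesis
    using par[of "U $ C $ C" "U $ D $ D"] par[of "U $ C $ D" "U $ D $ C"] U2_cmod[OF assms]
    by (simp add: pauli_weight_eq)
qed

text \<open>\<open>X\<close> and \<open>Y\<close> have zero diagonal and contribute nothing;
  \<open>I\<close> and \<open>Z\<close> produce x + y and x - y, the two terms of
  \<open>cmod_combination_pauli\<close>.\<close>

lemma outcome_prob_pauli_diag:
  assumes U: "U \<in> U2" and "Im (x * cnj y) = 0"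
    and "\<And>V. evolve \<theta> (V, Q) (ket C C) $ i = x * V $ C $ C + y * V $ D $ D"
  shows "outcome_prob \<theta> (U, Q) i = pauli_sum U (\<lambda>P. outcome_prob \<theta> (P, Q) i)"
  unfolding outcome_prob_def assms(3)
  using cmod_combination_pauli[OF U2_cmod(1)[OF U] assms(2)]
  by (simp add: pauli_weight_eq pauli_nth)

lemma outcome_prob_pauli_offdiag:
  assumes U: "U \<in> U2" and "Im (x * cnj y) = 0"
    and "\<And>V. evolve \<theta> (V, Q) (ket C C) $ i = x * V $ C $ D + y * V $ D $ C"
  shows "outcome_prob \<theta> (U, Q) i = pauli_sum U (\<lambda>P. outcome_prob \<theta> (P, Q) i)"
proof -
  \<comment> \<open>The off-diagonal entries of \<open>X\<close> give x + y directly; those of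
    \<open>Y\<close> are -i and i, which gives x - y only up to a phase.\<close>
  have "y * \<i> - x * \<i> = - \<i> * (x - y)" by (simp add: algebra_simps)
  then have "cmod (y * \<i> - x * \<i>) = cmod (x - y)" by (simp add: norm_mult)
  then show ?thesis
    unfolding outcome_prob_def assms(3)
    using cmod_combination_pauli[OF U2_cmod(2)[OF U] assms(2)]
    by (simp add: pauli_weight_eq pauli_nth)
qed

text \<open>Against a Pauli matrix every amplitude is a combination of either the two diagonal or the two
  off-diagonal entries of \<open>U\<close>, with coefficients of real ratio, so the Pauli components of \<open>U\<close> do
  not interfere. Hence the Pauli mini-max value also binds against arbitrary unitaries.\<close>

lemma outcome_prob_pauli:
  assumes U: "U \<in> U2" and Q: "Q \<in> paulis"
  shows "outcome_prob \<theta> (U, Q) i = pauli_sum U (\<lambda>P. outcome_prob \<theta> (P, Q) i)"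
proof -
  define c where "c = complex_of_real (cos (\<theta> / 2))"
  define d where "d = \<i> * complex_of_real (sin (\<theta> / 2))"
  note ev = evolve_nth[of \<theta> _ Q, folded c_def d_def]
  note diag = outcome_prob_pauli_diag[OF U] and offdiag = outcome_prob_pauli_offdiag[OF U]
  show ?thesis
  \<comment> \<open>For diagonal \<open>Q\<close> the outcomes with equal letters read the diagonal
    of \<open>U\<close> and the others its off-diagonal; for antidiagonal \<open>Q\<close> it is the
    other way round.\<close>
  proof (cases "Q = mat 1 \<or> Q = pauli_Z")
    case True
    then have q: "Q $ C $ D = 0" "Q $ D $ C = 0" "Im (Q $ C $ C) = 0" "Im (Q $ D $ D) = 0"
      by (auto simp: pauli_nth)
    consider "i = (C, C)" | "i = (D, D)" | "i = (C, D)" | "i = (D, C)"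
      by (metis move.exhaust surj_pair)
    then show ?thesis
    proof cases
      case 1
      then show ?thesis
        by (intro diag[of "c * c * Q $ C $ C" "- (d * d * Q $ D $ D)"])
           (use q in \<open>simp_all add: ev c_def d_def algebra_simps\<close>)
    next
      case 2
      then show ?thesis
        by (intro diag[of "d * c * Q $ C $ C" "- (c * d * Q $ D $ D)"])
           (use q in \<open>simp_all add: ev c_def d_def algebra_simps\<close>)
    next
      case 3
      then show ?thesis
        by (intro offdiag[of "- (c * d * Q $ D $ D)" "- (d * c * Q $ C $ C)"])
           (use q in \<open>simp_all add: ev c_def d_def algebra_simps\<close>)
    next
      case 4
      then show ?thesis
        by (intro offdiag[of "d * d * Q $ D $ D" "c * c * Q $ C $ C"])
           (use q in \<open>simp_all add: ev c_def d_def algebra_simps\<close>)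
    qed
  next
    case False
    then have q: "Q $ C $ C = 0" "Q $ D $ D = 0" "Im (Q $ C $ D * cnj (Q $ D $ C)) = 0"
      using Q by (auto simp: pauli_nth)
    consider "i = (C, C)" | "i = (D, D)" | "i = (C, D)" | "i = (D, C)"
      by (metis move.exhaust surj_pair)
    then show ?thesis
    proof cases
      case 1
      then show ?thesis
        by (intro offdiag[of "- (c * d * Q $ C $ D)" "d * c * Q $ D $ C"])
           (use q in \<open>simp_all add: ev c_def d_def algebra_simps\<close>)
    next
      case 2
      then show ?thesis
        by (intro offdiag[of "- (d * d * Q $ C $ D)" "c * c * Q $ D $ C"])
           (use q in \<open>simp_all add: ev c_def d_def algebra_simps\<close>)
    next
      case 3
      then show ?thesis
        by (intro diag[of "c * c * Q $ D $ C" "d * d * Q $ C $ D"])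
           (use q in \<open>simp_all add: ev c_def d_def algebra_simps\<close>)
    next
      case 4
      then show ?thesis
        by (intro diag[of "- (d * c * Q $ D $ C)" "- (c * d * Q $ C $ D)"])
           (use q in \<open>simp_all add: ev c_def d_def algebra_simps\<close>)
    qed
  qed
qed

lemma payoff_pauli:
  assumes "U \<in> U2" and "Q \<in> paulis"
  shows "payoff \<theta> (reward_A t r p s) (U, Q)
       = pauli_sum U (\<lambda>P. payoff \<theta> (reward_A t r p s) (P, Q))"
  unfolding payoff_eq outcome_prob_pauli[OF assms] by (simp add: algebra_simps)

section \<open>Discounted sequences and trigger strategies\<close>

text \<open>Computed with nonnegative integrals, for which the iterated-integral rule for a bind
  holds outright. The bounds, assumed for all arguments, then lead back to real
  expectations.\<close>

lemma expectation_bind_pmf_le: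
  fixes f :: "'b \<Rightarrow> real" and F :: "'a \<Rightarrow> real"
  assumes f: "\<And>y. 0 \<le> f y" "\<And>y. f y \<le> c"
    and F: "\<And>x. 0 \<le> F x" "\<And>x. F x \<le> c"
    and le: "\<And>x. x \<in> set_pmf M \<Longrightarrow> measure_pmf.expectation (N x) f \<le> F x"
  shows "measure_pmf.expectation (bind_pmf M N) f \<le> measure_pmf.expectation M F"
proof -
  have int: "integrable (measure_pmf q) f" for q
    using f by (intro measure_pmf.integrable_const_bound[where B = c]) auto
  have intF: "integrable (measure_pmf M) F"
    using F by (intro measure_pmf.integrable_const_bound[where B = c]) auto
  have "ennreal (measure_pmf.expectation (bind_pmf M N) f) = (\<integral>\<^sup>+y. f y \<partial>bind_pmf M N)"
    by (rule nn_integral_eq_integral[symmetric]) (use f int in auto)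
  also have "\<dots> = (\<integral>\<^sup>+x. \<integral>\<^sup>+y. f y \<partial>N x \<partial>M)"
    by simp
  also have "\<dots> = (\<integral>\<^sup>+x. ennreal (measure_pmf.expectation (N x) f) \<partial>M)"
    by (intro nn_integral_cong nn_integral_eq_integral) (use f int in auto)
  also have "\<dots> \<le> (\<integral>\<^sup>+x. ennreal (F x) \<partial>M)"
    by (intro nn_integral_mono_AE) (use le in \<open>auto simp: AE_measure_pmf_iff ennreal_leI\<close>)
  also have "\<dots> = ennreal (measure_pmf.expectation M F)"
    by (rule nn_integral_eq_integral) (use F intF in auto)
  finally show ?thesis
    using F by (simp add: ennreal_le_iff Bochner_Integration.integral_nonneg)
qed

text \<open>\<open>x k\<close> is the discounted frequency of ones from \<open>k\<close> on. Choosing \<open>b k = 1\<close> iff \<open>x k \<ge> l\<close>, unless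
  this would drive \<open>x (Suc k)\<close> out of the unit interval, keeps every tail frequency near \<open>l\<close>.\<close>

lemma greedy_discounted_sequence:
  fixes \<delta> l :: real
  assumes "1 / 2 \<le> \<delta>" "\<delta> < 1" "0 \<le> l" "l \<le> 1"
  obtains x b :: "nat \<Rightarrow> real" where "x 0 = l" "\<And>k. x k \<in> {0..1}" "\<And>k. b k \<in> {0, 1}"
    "\<And>k. x k = (1 - \<delta>) * b k + \<delta> * x (Suc k)" "\<And>k. \<bar>x k - l\<bar> \<le> (1 - \<delta>) / \<delta>"
proof -
  \<comment> \<open>Choosing 0 sends y to y / \<delta>, which exceeds 1 exactly when y > \<delta>;
    choosing 1 sends y to (y - (1 - \<delta>)) / \<delta>, which is negative exactly when y < 1 -
    \<delta>. These two cases override the comparison with \<open>l\<close>.\<close>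
  define \<beta> :: "real \<Rightarrow> real" where "\<beta> y = (if \<delta> < y \<or> (l \<le> y \<and> 1 - \<delta> \<le> y) then 1 else 0)" for y
  define x where "x = rec_nat l (\<lambda>_ y. (y - (1 - \<delta>) * \<beta> y) / \<delta>)"
  have x0: "x 0 = l" and xS: "x (Suc k) = (x k - (1 - \<delta>) * \<beta> (x k)) / \<delta>" for k
    by (simp_all add: x_def)
  let ?h = "(1 - \<delta>) / \<delta>"
  have h: "0 \<le> ?h" using assms by simp
  have step: "0 \<le> (y - (1 - \<delta>) * \<beta> y) / \<delta> \<and> (y - (1 - \<delta>) * \<beta> y) / \<delta> \<le> 1
      \<and> \<bar>(y - (1 - \<delta>) * \<beta> y) / \<delta> - l\<bar> \<le> ?h"
    if y: "0 \<le> y" "y \<le> 1" "\<bar>y - l\<bar> \<le> ?h" for y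
  proof (cases "\<delta> < y \<or> (l \<le> y \<and> 1 - \<delta> \<le> y)")
    case True
    then have "\<beta> y = 1" by (simp add: \<beta>_def)
    \<comment> \<open>Either choice moves y by at most \<open>?h\<close>, and towards
      \<open>l\<close> or across it unless the choice was forced; this is the origin of the
      tolerance.\<close>
    moreover have e: "(y - (1 - \<delta>)) / \<delta> = y - ?h * (1 - y)"
      using assms by (simp add: field_simps)
    moreover have "?h * (1 - y) \<le> ?h * 1" "0 \<le> ?h * (1 - y)"
      using y h by (intro mult_left_mono mult_nonneg_nonneg; simp)+
    \<comment> \<open>Here \<delta> \<ge> 1/2 matters: y > \<delta> then implies y \<ge> 1 -
      \<delta>, so the two forced choices never conflict.\<close>
    moreover have "1 - \<delta> \<le> y" using True assms by auto
    then have "0 \<le> (y - (1 - \<delta>)) / \<delta>" using assms by simp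
    moreover have "l - ?h \<le> y - ?h * (1 - y)"
    proof (cases "l \<le> y")
      case True
      then show ?thesis using \<open>?h * (1 - y) \<le> ?h * 1\<close> by simp
    next
      case False
      \<comment> \<open>A forced 1 below \<open>l\<close>: the new value is still at least 1 -
        \<open>?h\<close>, and l \<le> 1.\<close>
      then have "\<delta> < y" using True by simp
      then have "(1 - ?h) \<le> (y - (1 - \<delta>)) / \<delta>" using assms by (simp add: field_simps)
      then show ?thesis using e assms by simp
    qed
    ultimately show ?thesis using y by auto
  next
    case False
    then have "\<beta> y = 0" by (simp add: \<beta>_def)
    moreover have e: "y / \<delta> = y + ?h * y"
      using assms by (simp add: field_simps)
    moreover have "?h * y \<le> ?h * 1" "0 \<le> ?h * y"
      using y h by (intro mult_left_mono mult_nonneg_nonneg; simp)+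
    moreover have "y / \<delta> \<le> 1" "0 \<le> y / \<delta>" using False assms y by auto
    moreover have "y / \<delta> \<le> l + ?h"
    proof (cases "l \<le> y")
      case True
      then have "y \<le> 1 - \<delta>" using False by simp
      then have "y / \<delta> \<le> ?h" using assms by (simp add: divide_right_mono)
      then show ?thesis using assms by simp
    next
      case False
      then show ?thesis using e \<open>?h * y \<le> ?h * 1\<close> by simp
    qed
    ultimately show ?thesis using y by auto
  qed
  have inv: "0 \<le> x k \<and> x k \<le> 1 \<and> \<bar>x k - l\<bar> \<le> ?h" for k
  proof (induction k)
    case (Suc k)
    then show ?case unfolding xS by (intro step) auto
  qed (use assms x0 h in auto)
  show thesis
  proof (rule that[of x "\<lambda>k. \<beta> (x k)"])
    show "x k = (1 - \<delta>) * \<beta> (x k) + \<delta> * x (Suc k)" for k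
      using assms by (simp add: xS)
  qed (use inv x0 in \<open>auto simp: \<beta>_def\<close>)
qed

text \<open>By the recursion, (1 - \<delta>) \<delta>^k g(k) is the difference of consecutive terms
  \<delta>^k w(k), which tend to 0 because \<open>w\<close> is bounded. The numerator \<delta>
  reflects that the first reward is already discounted once.\<close>

lemma discounted_total:
  fixes g w :: "nat \<Rightarrow> real"
  assumes "0 < \<delta>" "\<delta> < 1" and w: "\<And>k. w k = (1 - \<delta>) * g k + \<delta> * w (Suc k)" "\<And>k. \<bar>w k\<bar> \<le> c"
  shows "(\<lambda>k. \<delta> ^ Suc k * g k) sums (\<delta> / (1 - \<delta>) * w 0)"
proof -
  have "(\<lambda>k. \<delta> ^ k * w k) \<longlonglongrightarrow> 0"
  proof (rule Lim_null_comparison)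
    show "\<forall>\<^sub>F k in sequentially. norm (\<delta> ^ k * w k) \<le> \<delta> ^ k * c"
      using assms(1) w(2) by (auto simp: abs_mult intro!: always_eventually mult_left_mono)
    show "(\<lambda>k. \<delta> ^ k * c) \<longlonglongrightarrow> 0"
      using assms(1,2) by (intro tendsto_mult_left_zero LIMSEQ_power_zero) auto
  qed
  from sums_mult[OF telescope_sums'[OF this], of "\<delta> / (1 - \<delta>)"]
  have "(\<lambda>k. \<delta> / (1 - \<delta>) * (\<delta> ^ k * w k - \<delta> ^ Suc k * w (Suc k))) sums (\<delta> / (1 - \<delta>) * w 0)"
    by simp
  moreover have "\<delta> / (1 - \<delta>) * (\<delta> ^ k * w k - \<delta> ^ Suc k * w (Suc k)) = \<delta> ^ Suc k * g k" for k
    using assms(1,2) by (subst w(1)[of k]) (simp add: field_simps)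
  ultimately show ?thesis by simp
qed

lemma set_pmf_play_length: "h \<in> set_pmf (play \<sigma> \<tau> k) \<Longrightarrow> length h = k"
  by (induction k arbitrary: h) auto

text \<open>The potential of a history is the continuation value \<open>w k\<close> on the prescribed path and the
  punishment level \<open>m\<close> off it: no play raises the expectation of \<open>1 - \<delta>\<close> times the next payoff plus
  \<open>\<delta>\<close> times the next potential above the current potential.\<close>

lemma trigger_bound:
  fixes G :: "history \<Rightarrow> real" and H :: "nat \<Rightarrow> history" and w :: "nat \<Rightarrow> real"
  assumes \<delta>: "0 < \<delta>" "\<delta> < 1"
    and G: "\<And>h. 0 \<le> G h" "\<And>h. G h \<le> c" and H: "H 0 = []" "\<And>k. tl (H (Suc k)) = H k"
    and w: "\<And>k. w k = (1 - \<delta>) * G (H (Suc k)) + \<delta> * w (Suc k)" "\<And>k. w k \<le> c"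
    and m: "0 \<le> m" "m \<le> c" and deviation: "\<And>k. (1 - \<delta>) * c + \<delta> * m \<le> w k"
    and punish: "\<And>k h. h \<in> set_pmf (play \<sigma> \<tau> k) \<Longrightarrow> h \<noteq> H k \<Longrightarrow>
        measure_pmf.expectation (pair_pmf (\<sigma> h) (\<tau> h)) (\<lambda>a. G (a # h)) \<le> m"
  shows "(\<Sum>k. \<delta> ^ Suc k * measure_pmf.expectation (play \<sigma> \<tau> (Suc k)) G) \<le> \<delta> / (1 - \<delta>) * w 0"
proof -
  define \<Phi> where "\<Phi> k h = (if h = H k then w k else m)" for k h
  define E where "E k f = measure_pmf.expectation (play \<sigma> \<tau> k) f" for k and f :: "history \<Rightarrow> real"
  have c: "0 \<le> c" using G[of "[]"] by simp
  have w0: "0 \<le> w k" for k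
    using deviation[of k] \<delta> c m by (smt (verit) mult_nonneg_nonneg)
  have \<Phi>: "0 \<le> \<Phi> k h" "\<Phi> k h \<le> c" for k h
    using w0 w(2) m by (auto simp: \<Phi>_def)
  have mix: "0 \<le> (1 - \<delta>) * G h + \<delta> * \<Phi> k h" "(1 - \<delta>) * G h + \<delta> * \<Phi> k h \<le> c" for k h
  proof -
    show "0 \<le> (1 - \<delta>) * G h + \<delta> * \<Phi> k h" using \<delta> G \<Phi> by simp
    have "(1 - \<delta>) * G h + \<delta> * \<Phi> k h \<le> (1 - \<delta>) * c + \<delta> * c"
      using \<delta> G \<Phi> by (intro add_mono mult_left_mono) auto
    then show "(1 - \<delta>) * G h + \<delta> * \<Phi> k h \<le> c" by (simp add: algebra_simps)
  qed
  have int: "integrable (measure_pmf q) f" if "\<And>x. 0 \<le> f x" "\<And>x. f x \<le> c"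
    for q :: "'x pmf" and f :: "'x \<Rightarrow> real"
    using that by (intro measure_pmf.integrable_const_bound[where B = c]) auto
  have I: "integrable (measure_pmf (play \<sigma> \<tau> n)) G" "integrable (measure_pmf (play \<sigma> \<tau> n)) (\<Phi> j)" for n j
    using G \<Phi> by (auto intro: int)
  have step: "(1 - \<delta>) * E (Suc k) G + \<delta> * E (Suc k) (\<Phi> (Suc k)) \<le> E k (\<Phi> k)" for k
  proof -
    have "(1 - \<delta>) * E (Suc k) G + \<delta> * E (Suc k) (\<Phi> (Suc k))
        = E (Suc k) (\<lambda>h. (1 - \<delta>) * G h + \<delta> * \<Phi> (Suc k) h)"
      using I[of "Suc k"] unfolding E_def by (simp del: play.simps)
    also have "\<dots> \<le> E k (\<Phi> k)"
      unfolding E_def play.simps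
    proof (rule expectation_bind_pmf_le[OF mix \<Phi>])
      fix h assume h: "h \<in> set_pmf (play \<sigma> \<tau> k)"
      let ?q = "pair_pmf (\<sigma> h) (\<tau> h)"
      have "measure_pmf.expectation ?q (\<lambda>a. (1 - \<delta>) * G (a # h) + \<delta> * \<Phi> (Suc k) (a # h)) \<le> \<Phi> k h"
      proof (cases "h = H k")
        case True
        have "(1 - \<delta>) * G (a # h) + \<delta> * \<Phi> (Suc k) (a # h) \<le> w k" for a
        proof (cases "a # h = H (Suc k)")
          case True
          then show ?thesis by (simp add: \<Phi>_def w(1)[of k])
        next
          case False
          \<comment> \<open>The first departure earns at most \<open>c\<close> for one round and
            leaves the potential at \<open>m\<close>.\<close>
          have "(1 - \<delta>) * G (a # h) \<le> (1 - \<delta>) * c" using \<delta> G by simp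
          then show ?thesis using False deviation[of k] by (simp add: \<Phi>_def)
        qed
        then show ?thesis
          using True mix by (intro measure_pmf.integral_le_const int) (auto simp: \<Phi>_def)
      next
        case False
        \<comment> \<open>The prescribed histories form a single chain of tails, so a history that
          has left it never returns.\<close>
        then have "\<Phi> (Suc k) (a # h) = m" for a
          using H(2)[of k] by (metis \<Phi>_def list.sel(3))
        then have "measure_pmf.expectation ?q (\<lambda>a. (1 - \<delta>) * G (a # h) + \<delta> * \<Phi> (Suc k) (a # h))
            = (1 - \<delta>) * measure_pmf.expectation ?q (\<lambda>a. G (a # h)) + \<delta> * m"
          using G by (simp add: int)
        also have "\<dots> \<le> (1 - \<delta>) * m + \<delta> * m"
          using punish[OF h False] \<delta> by (intro add_right_mono mult_left_mono) auto
        finally show ?thesis using False by (simp add: \<Phi>_def algebra_simps)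
      qed
      then show "measure_pmf.expectation (map_pmf (\<lambda>a. a # h) ?q)
          (\<lambda>h. (1 - \<delta>) * G h + \<delta> * \<Phi> (Suc k) h) \<le> \<Phi> k h"
        by simp
    qed
    finally show ?thesis .
  qed
  have E0: "0 \<le> E k f" "E k f \<le> c" if "\<And>h. 0 \<le> f h" "\<And>h. f h \<le> c" for k f
    unfolding E_def using that int[OF that]
    by (auto intro!: Bochner_Integration.integral_nonneg measure_pmf.integral_le_const)
  \<comment> \<open>Weighted by \<delta>^n, the one-step inequalities telescope, starting from
    potential \<open>w 0\<close> at the empty history.\<close>
  have partial: "(\<Sum>k<n. \<delta> ^ k * ((1 - \<delta>) * E (Suc k) G)) + \<delta> ^ n * E n (\<Phi> n) \<le> w 0" for n
  proof (induction n)
    case 0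
    then show ?case by (simp add: E_def \<Phi>_def H)
  next
    case (Suc n)
    have "\<delta> ^ n * ((1 - \<delta>) * E (Suc n) G + \<delta> * E (Suc n) (\<Phi> (Suc n))) \<le> \<delta> ^ n * E n (\<Phi> n)"
      using step \<delta> by (intro mult_left_mono) auto
    then show ?case using Suc by (simp add: algebra_simps)
  qed
  have "(\<Sum>k<n. \<delta> ^ Suc k * E (Suc k) G) \<le> \<delta> / (1 - \<delta>) * w 0" for n
  proof -
    have "(\<Sum>k<n. \<delta> ^ Suc k * E (Suc k) G)
        = \<delta> / (1 - \<delta>) * (\<Sum>k<n. \<delta> ^ k * ((1 - \<delta>) * E (Suc k) G))"
      unfolding sum_distrib_left using \<delta> by (intro sum.cong) auto
    also have "\<dots> \<le> \<delta> / (1 - \<delta>) * w 0"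
    proof (rule mult_left_mono)
      have "0 \<le> \<delta> ^ n * E n (\<Phi> n)" using \<delta> E0(1)[OF \<Phi>] by simp
      then show "(\<Sum>k<n. \<delta> ^ k * ((1 - \<delta>) * E (Suc k) G)) \<le> w 0"
        using partial[of n] by linarith
    qed (use \<delta> in simp)
    finally show ?thesis .
  qed
  moreover have "summable (\<lambda>k. \<delta> ^ Suc k * E (Suc k) G)"
  proof (rule summable_comparison_test)
    show "\<exists>N. \<forall>k\<ge>N. norm (\<delta> ^ Suc k * E (Suc k) G) \<le> \<delta> ^ k * c"
    proof (intro exI allI impI)
      fix k
      have "\<delta> ^ Suc k * E (Suc k) G \<le> \<delta> ^ k * c"
        using \<delta> E0[OF G] c by (intro mult_mono) (auto simp: mult_left_le_one_le)
      then show "norm (\<delta> ^ Suc k * E (Suc k) G) \<le> \<delta> ^ k * c"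
        using \<delta> E0[OF G] by simp
    qed
    show "summable (\<lambda>k. \<delta> ^ k * c)"
      using \<delta> by (intro summable_mult2 summable_geometric) auto
  qed
  ultimately show ?thesis
    unfolding E_def by (intro suminf_le_const) auto
qed

section \<open>Mini-max values and feasible payoffs\<close>

lemma reward_B_eq: "reward_B t r p s = reward_A s r p t"
  by (simp add: reward_B_def)

lemma mixed_payoff_swap:
  "mixed_payoff \<theta> (reward_A t r p s) pB pA = mixed_payoff \<theta> (reward_A s r p t) pA pB"
  unfolding mixed_payoff_def
  by (subst pair_commute_pmf) (simp add: case_prod_unfold payoff_swap[of _ t r p s])

text \<open>By symmetry of the game, a single mixture and a single level \<open>m\<close> punish
  either player.\<close>

lemma minimax_B_eq: "minimax_B t r p s \<theta> = minimax_A t r p s \<theta>"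
  by (simp add: minimax_A_def minimax_B_def reward_B_eq mixed_payoff_swap[of _ t r p s])

lemma mixed_payoff_bounds:
  assumes "pA \<in> mixed_strategies" "pB \<in> mixed_strategies" and "{t, r, p, s} \<subseteq> {0..c}"
  shows "0 \<le> mixed_payoff \<theta> (reward_A t r p s) pA pB" "mixed_payoff \<theta> (reward_A t r p s) pA pB \<le> c"
proof -
  have fin: "finite (set_pmf (pair_pmf pA pB))"
    using assms(1,2) by (auto simp: mixed_strategies_def intro: finite_subset)
  have "set_pmf (pair_pmf pA pB) \<subseteq> U2U2"
    using assms(1,2) U2_pauli by (auto simp: mixed_strategies_def)
  then have b: "0 \<le> payoff \<theta> (reward_A t r p s) a" "payoff \<theta> (reward_A t r p s) a \<le> c"
    if "a \<in> set_pmf (pair_pmf pA pB)" for a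
    using payoff_bounds[OF _ assms(3)] that by blast+
  show "0 \<le> mixed_payoff \<theta> (reward_A t r p s) pA pB"
    unfolding mixed_payoff_def
    by (intro integral_nonneg_AE) (use b in \<open>simp add: AE_measure_pmf_iff\<close>)
  show "mixed_payoff \<theta> (reward_A t r p s) pA pB \<le> c"
    unfolding mixed_payoff_def
    by (intro measure_pmf.integral_le_const integrable_measure_pmf_finite fin)
       (use b in \<open>simp add: AE_measure_pmf_iff\<close>)
qed

text \<open>Some mixture has its best-reply value \<open>m\<close> within \<epsilon> of the infimum.
  Point masses bound each Pauli reply by \<open>m\<close>, and a unitary reply earns an average of
  these with weights \<open>pauli_weight\<close>, which sum to 1.\<close>

lemma minimax_punishment:
  assumes c: "{t, r, p, s} \<subseteq> {0..c}" and "0 < \<epsilon>"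
  obtains q m where "q \<in> mixed_strategies" "0 \<le> m" "m \<le> c" "m < minimax_A t r p s \<theta> + \<epsilon>"
    "\<And>U. U \<in> U2 \<Longrightarrow> measure_pmf.expectation q (\<lambda>Q. payoff \<theta> (reward_A t r p s) (U, Q)) \<le> m"
proof -
  let ?M = "reward_A t r p s"
  have one: "return_pmf P \<in> mixed_strategies" if "P \<in> paulis" for P
    using that by (auto simp: mixed_strategies_def)
  then have ne: "mixed_strategies \<noteq> {}" by blast
  have "minimax_A t r p s \<theta> < minimax_A t r p s \<theta> + \<epsilon>" using \<open>0 < \<epsilon>\<close> by simp
  then obtain q where q: "q \<in> mixed_strategies"
    and lt: "(SUP pA\<in>mixed_strategies. mixed_payoff \<theta> ?M pA q) < minimax_A t r p s \<theta> + \<epsilon>"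
    using cInf_lessD[of "(\<lambda>pB. SUP pA\<in>mixed_strategies. mixed_payoff \<theta> ?M pA pB) ` mixed_strategies"] ne
    unfolding minimax_A_def by blast
  define m where "m = (SUP pA\<in>mixed_strategies. mixed_payoff \<theta> ?M pA q)"
  have bdd: "bdd_above ((\<lambda>pA. mixed_payoff \<theta> ?M pA q) ` mixed_strategies)"
    using mixed_payoff_bounds[OF _ q c] by (auto intro!: bdd_aboveI2)
  have le_m: "mixed_payoff \<theta> ?M pA q \<le> m" if "pA \<in> mixed_strategies" for pA
    unfolding m_def using that bdd by (rule cSUP_upper)
  have fin: "finite (set_pmf q)" and qP: "set_pmf q \<subseteq> paulis"
    using q by (auto simp: mixed_strategies_def intro: finite_subset)
  define e where "e U = measure_pmf.expectation q (\<lambda>Q. payoff \<theta> ?M (U, Q))" for U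
  have e_le: "e P \<le> m" if "P \<in> paulis" for P
    using le_m[OF one[OF that]] by (simp add: mixed_payoff_def pair_return_pmf1 e_def)
  show thesis
  proof (rule that[of q m])
    show "0 \<le> m"
      using le_m[of "return_pmf (mat 1)"] mixed_payoff_bounds(1)[OF _ q c, of "return_pmf (mat 1)" \<theta>] one
      by force
    show "m \<le> c"
      unfolding m_def using ne mixed_payoff_bounds(2)[OF _ q c] by (intro cSUP_least) auto
    show "measure_pmf.expectation q (\<lambda>Q. payoff \<theta> ?M (U, Q)) \<le> m" if U: "U \<in> U2" for U
    proof -
      have "e U = measure_pmf.expectation q (\<lambda>Q. pauli_sum U (\<lambda>P. payoff \<theta> ?M (P, Q)))"
        unfolding e_def using qP
        by (intro integral_cong_AE) (auto simp: AE_measure_pmf_iff intro!: payoff_pauli[OF U])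
      also have "\<dots> = pauli_sum U e"
        unfolding e_def using fin by (simp add: integrable_measure_pmf_finite)
      also have "\<dots> \<le> pauli_sum U (\<lambda>_. m)"
        by (intro add_mono mult_left_mono e_le) (auto simp: pauli_weight_def)
      also have "\<dots> = pauli_sum U (\<lambda>_. 1) * m"
        by (simp add: algebra_simps)
      finally show ?thesis
        by (simp only: e_def pauli_weight_sum[OF U] mult_1)
    qed
  qed (use q lt m_def in auto)
qed

section \<open>Feasible payoffs and the classical game inside the quantum game\<close>

lemma continuous_on_outcome_prob: "continuous_on S (\<lambda>a. outcome_prob \<theta> a i)"
proof -
  have "continuous_on S (\<lambda>a. outcome_prob \<theta> (fst a, snd a) (j, k))" for j k
    unfolding outcome_prob_def
    by (cases j; cases k; simp only: evolve_nth; intro continuous_intros)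
  from this[of "fst i" "snd i"] show ?thesis by simp
qed

text \<open>An action pair earns the four classical profiles weighted by its outcome probabilities.
  Averaging these against the density \<open>f\<close>, which has total mass 1, preserves
  nonnegativity and the sum 1.\<close>

lemma feasible_convex_combination:
  assumes \<mu>: "haar_prob \<mu>" and \<nu>: "\<nu> \<in> feasible t r p s \<theta> \<mu>"
  obtains q :: "move \<times> move \<Rightarrow> real" where "\<And>i. 0 \<le> q i" "q (C, C) + q (C, D) + q (D, C) + q (D, D) = 1"
    "\<nu> = q (C, C) *\<^sub>R (r, r) + q (D, D) *\<^sub>R (p, p) + q (D, C) *\<^sub>R (t, s) + q (C, D) *\<^sub>R (s, t)"
proof -
  have sp: "space \<mu> = U2U2" and se: "sets \<mu> = sets (restrict_space borel U2U2)"
    using \<mu> by (auto simp: haar_prob_def)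
  obtain f where "\<forall>a\<in>U2U2. 0 \<le> f a" and f: "integrable \<mu> f" "(\<integral>a. f a \<partial>\<mu>) = 1"
    and \<nu>_eq: "\<nu> = (\<integral>a. f a *\<^sub>R (payoff \<theta> (reward_A t r p s) a, payoff \<theta> (reward_B t r p s) a) \<partial>\<mu>)"
    using \<nu> unfolding feasible_def mem_Collect_eq by (elim exE conjE)
  then have f0: "0 \<le> f a" if "a \<in> U2U2" for a
    using that by (elim bspec)
  have le1: "outcome_prob \<theta> a i \<le> 1" if "a \<in> U2U2" for a i
  proof -
    have "outcome_prob \<theta> a i \<le> (\<Sum>i\<in>UNIV. outcome_prob \<theta> a i)"
      by (intro member_le_sum) auto
    then show ?thesis by (simp add: sum_move_pair outcome_prob_sum[OF that])
  qed
  have meas: "(\<lambda>a. outcome_prob \<theta> a i) \<in> borel_measurable \<mu>" for i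
    unfolding measurable_cong_sets[OF se refl]
    by (rule borel_measurable_continuous_on_restrict) (rule continuous_on_outcome_prob)
  have int: "integrable \<mu> (\<lambda>a. f a * outcome_prob \<theta> a i)" for i
  proof (rule Bochner_Integration.integrable_bound[OF f(1)])
    show "(\<lambda>a. f a * outcome_prob \<theta> a i) \<in> borel_measurable \<mu>"
      using f(1) meas by (intro borel_measurable_times) auto
    show "AE a in \<mu>. norm (f a * outcome_prob \<theta> a i) \<le> norm (f a)"
      using le1[of _ i] by (intro AE_I2) (simp add: sp abs_mult mult_left_le)
  qed
  define q where "q i = (\<integral>a. f a * outcome_prob \<theta> a i \<partial>\<mu>)" for i
  show thesis
  proof (rule that[of q])
    show "0 \<le> q i" for i
      unfolding q_def using f0 by (intro integral_nonneg_AE AE_I2) (auto simp: sp)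
    have "q (C, C) + q (C, D) + q (D, C) + q (D, D)
        = (\<integral>a. f a * outcome_prob \<theta> a (C, C) + f a * outcome_prob \<theta> a (C, D)
            + f a * outcome_prob \<theta> a (D, C) + f a * outcome_prob \<theta> a (D, D) \<partial>\<mu>)"
      unfolding q_def by (simp add: int)
    also have "\<dots> = (\<integral>a. f a \<partial>\<mu>)"
      by (intro Bochner_Integration.integral_cong refl)
         (simp only: sp distrib_left[symmetric] outcome_prob_sum mult_1_right)
    finally show "q (C, C) + q (C, D) + q (D, C) + q (D, D) = 1"
      using f(2) by simp
    have "\<nu> = (\<integral>a. (f a * outcome_prob \<theta> a (C, C)) *\<^sub>R (r, r) + (f a * outcome_prob \<theta> a (D, D)) *\<^sub>R (p, p)
       + (f a * outcome_prob \<theta> a (D, C)) *\<^sub>R (t, s) + (f a * outcome_prob \<theta> a (C, D)) *\<^sub>R (s, t) \<partial>\<mu>)"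
      unfolding \<nu>_eq
      by (intro Bochner_Integration.integral_cong refl) (simp add: reward_B_eq payoff_eq algebra_simps)
    also have "\<dots> = q (C, C) *\<^sub>R (r, r) + q (D, D) *\<^sub>R (p, p) + q (D, C) *\<^sub>R (t, s) + q (C, D) *\<^sub>R (s, t)"
      using int by (simp only: q_def Bochner_Integration.integral_add Bochner_Integration.integrable_add
        integrable_scaleR_left integral_scaleR_left)
    finally show "\<nu> = q (C, C) *\<^sub>R (r, r) + q (D, D) *\<^sub>R (p, p) + q (D, C) *\<^sub>R (t, s) + q (C, D) *\<^sub>R (s, t)" .
  qed
qed

text \<open>This is sqrt(\<alpha>) \<open>I\<close> - i sqrt(1 - \<alpha>) \<open>Y\<close>: one
  pure action that imitates cooperating with probability \<alpha> and defecting otherwise when the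
  opponent plays \<open>I\<close> or \<open>Y\<close>.\<close>

definition rotation :: "real \<Rightarrow> qubit_op" where
  "rotation \<alpha> = (\<chi> i j. if i = j then complex_of_real (sqrt \<alpha>)
     else if i = C then - complex_of_real (sqrt (1 - \<alpha>)) else complex_of_real (sqrt (1 - \<alpha>)))"

lemma rotation_U2: "0 \<le> \<alpha> \<Longrightarrow> \<alpha> \<le> 1 \<Longrightarrow> rotation \<alpha> \<in> U2"
  by (simp add: U2_def qubit_op_eq_iff matrix_matrix_mult_def sum_move dagger_nth mat_def
      rotation_def flip: of_real_mult of_real_add)

lemma pauli_weight_rotation:
  assumes "0 \<le> \<alpha>" "\<alpha> \<le> 1"
  shows "pauli_weight (rotation \<alpha>) (mat 1) = \<alpha>" "pauli_weight (rotation \<alpha>) pauli_X = 0"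
    "pauli_weight (rotation \<alpha>) pauli_Y = 1 - \<alpha>" "pauli_weight (rotation \<alpha>) pauli_Z = 0"
  using assms by (simp_all add: pauli_weight_eq rotation_def norm_mult)

text \<open>\<open>I\<close> and \<open>Y\<close> commute with \<open>J\<close>, so the entanglement
  cancels: \<open>I\<close> acts as cooperation, \<open>Y\<close> as a bit flip up to phase, that is
  defection.\<close>

lemma payoff_classical:
  "payoff \<theta> (reward_A t r p s) (mat 1, mat 1) = r" "payoff \<theta> (reward_A t r p s) (pauli_Y, mat 1) = t"
  "payoff \<theta> (reward_A t r p s) (mat 1, pauli_Y) = s" "payoff \<theta> (reward_A t r p s) (pauli_Y, pauli_Y) = p"
proof -
  let ?c = "complex_of_real (cos (\<theta> / 2))" and ?d = "complex_of_real (sin (\<theta> / 2))"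
  have "x * (?c * ?c) + x * (?d * ?d) = x" for x
    using of_real_sin_cos[of "\<theta> / 2"] by (simp only: distrib_left[symmetric] mult_1_right)
  moreover have "cmod (- (?c * ?c) - ?d * ?d) = 1"
  proof -
    have "- (?c * ?c) - ?d * ?d = - (?c * ?c + ?d * ?d)" by simp
    then show ?thesis by (simp only: of_real_sin_cos norm_minus_cancel norm_one)
  qed
  ultimately show "payoff \<theta> (reward_A t r p s) (mat 1, mat 1) = r"
    "payoff \<theta> (reward_A t r p s) (pauli_Y, mat 1) = t"
    "payoff \<theta> (reward_A t r p s) (mat 1, pauli_Y) = s"
    "payoff \<theta> (reward_A t r p s) (pauli_Y, pauli_Y) = p"
    using of_real_sin_cos[of "\<theta> / 2"]
    by (simp_all add: payoff_eq outcome_prob_def evolve_nth pauli_nth algebra_simps)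
qed

lemma payoff_rotation:
  assumes "0 \<le> \<alpha>" "\<alpha> \<le> 1"
  shows "payoff \<theta> (reward_A t r p s) (rotation \<alpha>, mat 1) = \<alpha> * r + (1 - \<alpha>) * t"
    "payoff \<theta> (reward_A t r p s) (rotation \<alpha>, pauli_Y) = \<alpha> * s + (1 - \<alpha>) * p"
  using rotation_U2[OF assms] by (simp_all add: payoff_pauli pauli_weight_rotation[OF assms] payoff_classical)

section \<open>The equilibrium\<close>

text \<open>The two draws are independent, so a bound against each single action of the deviator
  survives any randomisation by the deviator.\<close>

lemma expectation_pair_pmf_le:
  fixes f :: "'a \<times> 'b \<Rightarrow> real"
  assumes f: "\<And>z. 0 \<le> f z" "\<And>z. f z \<le> c" and m: "0 \<le> m" "m \<le> c"
    and le: "\<And>x. x \<in> set_pmf M \<Longrightarrow> measure_pmf.expectation N (\<lambda>y. f (x, y)) \<le> m"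
  shows "measure_pmf.expectation (pair_pmf M N) f \<le> m"
proof -
  have "pair_pmf M N = bind_pmf M (\<lambda>x. map_pmf (Pair x) N)"
    by (simp add: pair_pmf_def map_pmf_def)
  moreover have "measure_pmf.expectation (bind_pmf M (\<lambda>x. map_pmf (Pair x) N)) f
      \<le> measure_pmf.expectation M (\<lambda>_. m)"
    by (rule expectation_bind_pmf_le[where c = c]) (use assms in auto)
  ultimately show ?thesis by simp
qed

section \<open>Strategies expressed through accumulated products\<close>

fun total_action :: "history \<Rightarrow> qubit_op \<times> qubit_op" where
  "total_action [] = (mat 1, mat 1)"
| "total_action (a # h) = (fst a ** fst (total_action h), snd a ** snd (total_action h))"

text \<open>Since \<open>J\<close> is unitary, the evolution telescopes: the state after a history is the one a single
  round with the products of the actions played so far would produce.\<close>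

lemma state_eq: "state \<theta> h = evolve \<theta> (total_action h) (ket C C)"
  by (induction h) (simp_all add: evolve_one evolve_compose)

lemma expval_state: "expval M (state \<theta> h) = payoff \<theta> M (total_action h)"
  by (simp add: state_eq payoff_def)

lemma total_action_play:
  assumes "\<sigma> \<in> rep_strategies" "\<tau> \<in> rep_strategies" "h \<in> set_pmf (play \<sigma> \<tau> k)"
  shows "total_action h \<in> U2U2"
  using assms(3)
proof (induction k arbitrary: h)
  case (Suc k)
  then obtain a h' where h: "h = a # h'" "h' \<in> set_pmf (play \<sigma> \<tau> k)" "fst a \<in> set_pmf (\<sigma> h')" "snd a \<in> set_pmf (\<tau> h')"
    by auto
  then have "fst a \<in> U2" "snd a \<in> U2"
    using assms(1,2) by (auto simp: rep_strategies_def)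
  then show ?case
    using Suc.IH[OF h(2)] by (auto simp: h(1) mem_Times_iff intro: U2_mult)
qed (simp add: U2_one)

text \<open>Each action first undoes the player's product so far, so that the new product is exactly
  the target. Note the shift: \<open>T k\<close> is reached by
  \<open>path T (Suc k)\<close>.\<close>

primrec path :: "(nat \<Rightarrow> qubit_op \<times> qubit_op) \<Rightarrow> nat \<Rightarrow> history" where
  "path T 0 = []"
| "path T (Suc k) = (fst (T k) ** dagger (fst (total_action (path T k))),
      snd (T k) ** dagger (snd (total_action (path T k)))) # path T k"

text \<open>\<open>T\<close> and \<open>q\<close> prescribe the products of the actions, not the actions themselves. The inner
  case distinction makes the strategy legal also after histories with non-unitary entries.\<close>

definition trigger ::
  "(qubit_op \<times> qubit_op \<Rightarrow> qubit_op) \<Rightarrow> (nat \<Rightarrow> qubit_op \<times> qubit_op) \<Rightarrow> qubit_op pmf \<Rightarrow> rep_strategy" where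
  "trigger pr T q h = map_pmf (\<lambda>U. U ** (if pr (total_action h) \<in> U2 then dagger (pr (total_action h)) else mat 1))
     (if h = path T (length h) then return_pmf (pr (T (length h))) else q)"

lemma U2_cancel:
  assumes "V \<in> U2"
  shows "U ** dagger V ** V = U"
  using assms by (simp add: U2_def matrix_mul_assoc[symmetric])

lemma length_path [simp]: "length (path T k) = k"
  by (induction k) simp_all

lemma total_action_path:
  assumes "\<And>k. T k \<in> U2U2"
  shows "total_action (path T k) \<in> U2U2" and "total_action (path T (Suc k)) = T k"
proof -
  have step: "total_action (path T (Suc k)) = T k" if "total_action (path T k) \<in> U2U2" for k
    using that by (simp add: mem_Times_iff U2_cancel)
  have *: "total_action (path T k) \<in> U2U2" for k
  proof (induction k)
    case (Suc k)
    then show ?case using step assms by metis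
  qed (simp add: U2_one)
  show "total_action (path T k) \<in> U2U2" by (rule *)
  show "total_action (path T (Suc k)) = T k" using * by (rule step)
qed

lemma play_trigger:
  assumes "\<And>k. T k \<in> U2U2"
  shows "play (trigger fst T q) (trigger snd T q') k = return_pmf (path T k)"
proof (induction k)
  case (Suc k)
  have "total_action (path T k) \<in> U2U2" using total_action_path(1)[OF assms] .
  then show ?case
    using Suc by (simp add: trigger_def bind_return_pmf mem_Times_iff)
qed simp

lemma trigger_rep_strategies:
  assumes "pr = fst \<or> pr = snd" "\<And>k. T k \<in> U2U2" "q \<in> mixed_strategies"
  shows "trigger pr T q \<in> rep_strategies"
proof -
  have "pr (T k) \<in> U2" for k using assms(1,2) by (auto simp: mem_Times_iff)
  moreover have "set_pmf q \<subseteq> U2" using assms(3) U2_pauli by (auto simp: mixed_strategies_def)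
  ultimately show ?thesis
    by (auto simp: rep_strategies_def trigger_def intro!: U2_mult U2_dagger U2_one)
qed

text \<open>Truncated to \<open>0\<close> where no play leads, so that it is bounded on all histories.\<close>

definition stage_value :: "real \<Rightarrow> two_qubit_op \<Rightarrow> history \<Rightarrow> real" where
  "stage_value \<theta> M h = (if total_action h \<in> U2U2 then payoff \<theta> M (total_action h) else 0)"

text \<open>Legal strategies keep all products unitary, so the truncation in
  \<open>stage_value\<close> changes nothing almost surely; the bounds required on all histories
  become available.\<close>

lemma stage_payoff_eq:
  assumes "\<sigma> \<in> rep_strategies" "\<tau> \<in> rep_strategies"
  shows "stage_payoff \<theta> M \<sigma> \<tau> k = measure_pmf.expectation (play \<sigma> \<tau> k) (stage_value \<theta> M)"
  unfolding stage_payoff_def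
  using total_action_play[OF assms]
  by (intro integral_cong_AE) (auto simp: AE_measure_pmf_iff stage_value_def expval_state)

lemma stage_value_bounds:
  assumes "{t, r, p, s} \<subseteq> {0..c}"
  shows "0 \<le> stage_value \<theta> (reward_A t r p s) h" "stage_value \<theta> (reward_A t r p s) h \<le> c"
  using assms payoff_bounds[OF _ assms] by (auto simp: stage_value_def)

text \<open>Bob's action undoes \<open>V\<close>, so his product becomes a fresh draw from
  \<open>q\<close>, independent of Alice's simultaneous \<open>x\<close>. Her product
  \<open>x ** U\<close> is again unitary, and the one-shot bound applies to it.\<close>

lemma trigger_punishes_A:
  assumes c: "{t, r, p, s} \<subseteq> {0..c}" and m: "0 \<le> m" "m \<le> c" and q: "q \<in> mixed_strategies"
    and punish: "\<And>U. U \<in> U2 \<Longrightarrow> measure_pmf.expectation q (\<lambda>Q. payoff \<theta> (reward_A t r p s) (U, Q)) \<le> m"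
    and \<sigma>: "\<sigma> \<in> rep_strategies" and h: "total_action h \<in> U2U2" "h \<noteq> path T (length h)"
  shows "measure_pmf.expectation (pair_pmf (\<sigma> h) (trigger snd T q h))
    (\<lambda>a. stage_value \<theta> (reward_A t r p s) (a # h)) \<le> m"
proof (rule expectation_pair_pmf_le[OF stage_value_bounds[OF c] m])
  let ?M = "reward_A t r p s"
  fix x assume x: "x \<in> set_pmf (\<sigma> h)"
  obtain U V where UV: "total_action h = (U, V)" "U \<in> U2" "V \<in> U2"
    using h(1) by auto
  have xU: "x ** U \<in> U2"
    using \<sigma> x UV by (auto simp: rep_strategies_def intro!: U2_mult)
  have "measure_pmf.expectation (trigger snd T q h) (\<lambda>y. stage_value \<theta> ?M ((x, y) # h))
      = measure_pmf.expectation q (\<lambda>Q. stage_value \<theta> ?M ((x, Q ** dagger V) # h))"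
    using h(2) UV by (simp add: trigger_def)
  also have "\<dots> = measure_pmf.expectation q (\<lambda>Q. payoff \<theta> ?M (x ** U, Q))"
    using q U2_pauli xU UV
    by (intro integral_cong_AE)
       (auto simp: AE_measure_pmf_iff stage_value_def U2_cancel mixed_strategies_def)
  also have "\<dots> \<le> m" by (rule punish[OF xU])
  finally show "measure_pmf.expectation (trigger snd T q h) (\<lambda>y. stage_value \<theta> ?M ((x, y) # h)) \<le> m" .
qed

text \<open>Exchanging the two draws puts the deviator first, and \<open>payoff_swap\<close> turns
  Bob's payoff into Alice's, so the same bound on \<open>q\<close> applies.\<close>

lemma trigger_punishes_B:
  assumes c: "{t, r, p, s} \<subseteq> {0..c}" and m: "0 \<le> m" "m \<le> c" and q: "q \<in> mixed_strategies"
    and punish: "\<And>U. U \<in> U2 \<Longrightarrow> measure_pmf.expectation q (\<lambda>Q. payoff \<theta> (reward_A t r p s) (U, Q)) \<le> m"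
    and \<tau>: "\<tau> \<in> rep_strategies" and h: "total_action h \<in> U2U2" "h \<noteq> path T (length h)"
  shows "measure_pmf.expectation (pair_pmf (trigger fst T q h) (\<tau> h))
    (\<lambda>a. stage_value \<theta> (reward_B t r p s) (a # h)) \<le> m"
proof -
  let ?M = "reward_B t r p s"
  have c': "{s, r, p, t} \<subseteq> {0..c}" using c by simp
  have "measure_pmf.expectation (pair_pmf (trigger fst T q h) (\<tau> h)) (\<lambda>a. stage_value \<theta> ?M (a # h))
      = measure_pmf.expectation (pair_pmf (\<tau> h) (trigger fst T q h))
          (\<lambda>a. stage_value \<theta> ?M ((snd a, fst a) # h))"
    by (subst pair_commute_pmf) (simp add: case_prod_unfold)
  also have "\<dots> \<le> m"
  proof (rule expectation_pair_pmf_le[OF _ _ m])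
    fix y assume y: "y \<in> set_pmf (\<tau> h)"
    obtain U V where UV: "total_action h = (U, V)" "U \<in> U2" "V \<in> U2"
      using h(1) by auto
    have yV: "y ** V \<in> U2"
      using \<tau> y UV by (auto simp: rep_strategies_def intro!: U2_mult)
    have "measure_pmf.expectation (trigger fst T q h) (\<lambda>x. stage_value \<theta> ?M ((snd (y, x), fst (y, x)) # h))
        = measure_pmf.expectation q (\<lambda>P. stage_value \<theta> ?M ((P ** dagger U, y) # h))"
      using h(2) UV by (simp add: trigger_def)
    also have "\<dots> = measure_pmf.expectation q (\<lambda>P. payoff \<theta> (reward_A t r p s) (y ** V, P))"
      using q U2_pauli yV UV
      by (intro integral_cong_AE)
         (auto simp: AE_measure_pmf_iff stage_value_def U2_cancel mixed_strategies_def reward_B_eq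
           payoff_swap[of _ t r p s])
    also have "\<dots> \<le> m" by (rule punish[OF yV])
    finally show "measure_pmf.expectation (trigger fst T q h)
        (\<lambda>x. stage_value \<theta> ?M ((snd (y, x), fst (y, x)) # h)) \<le> m" .
  qed (use stage_value_bounds[OF c'] in \<open>auto simp: reward_B_eq\<close>)
  finally show ?thesis .
qed

lemma total_payoff_trigger:
  assumes \<delta>: "0 < \<delta>" "\<delta> < 1" and T: "\<And>k. T k \<in> U2U2" and q: "q \<in> mixed_strategies"
    and w: "\<And>k. w k = (1 - \<delta>) * payoff \<theta> M (T k) + \<delta> * w (Suc k)" "\<And>k. \<bar>w k\<bar> \<le> c"
  shows "total_payoff \<theta> \<delta> M (trigger fst T q) (trigger snd T q) = \<delta> / (1 - \<delta>) * w 0"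
proof -
  have "stage_payoff \<theta> M (trigger fst T q) (trigger snd T q) (Suc k) = payoff \<theta> M (T k)" for k
    unfolding stage_payoff_def play_trigger[OF T]
    by (simp add: expval_state total_action_path(2)[OF T] del: path.simps)
  then show ?thesis
    using sums_unique[OF discounted_total[where g = "\<lambda>k. payoff \<theta> M (T k)" and w = w, OF \<delta> w]] by (simp add: total_payoff_def)
qed

lemma profit_per_round_eq:
  assumes "0 < \<delta>" "\<delta> < 1" and "total_payoff \<theta> \<delta> M \<sigma> \<tau> = \<delta> / (1 - \<delta>) * v"
  shows "profit_per_round \<theta> \<delta> M \<sigma> \<tau> = v"
proof -
  have "(\<Sum>k. \<delta> ^ Suc k) = \<delta> / (1 - \<delta>)"
    using sums_unique[OF discounted_total[OF assms(1,2), of "\<lambda>_. 1" "\<lambda>_. 1" 1]] by simp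
  then show ?thesis
    using assms by (simp add: profit_per_round_def)
qed

text \<open>\<open>wA\<close> and \<open>wB\<close> are the continuation values along
  \<open>T\<close>. Their lower bounds dominate the strongest temptation: one round at the maximal
  payoff \<open>c\<close>, then \<open>m\<close> forever. Applied to the chain
  \<open>path T\<close>, \<open>trigger_bound\<close> covers all deviations, including randomised
  and history-dependent ones.\<close>

lemma trigger_equilibrium:
  assumes c: "{t, r, p, s} \<subseteq> {0..c}" and \<delta>: "0 < \<delta>" "\<delta> < 1" and T: "\<And>k. T k \<in> U2U2"
    and m: "0 \<le> m" "m \<le> c" and q: "q \<in> mixed_strategies"
    and punish: "\<And>U. U \<in> U2 \<Longrightarrow> measure_pmf.expectation q (\<lambda>Q. payoff \<theta> (reward_A t r p s) (U, Q)) \<le> m"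
    and wA: "\<And>k. wA k = (1 - \<delta>) * payoff \<theta> (reward_A t r p s) (T k) + \<delta> * wA (Suc k)"
      "\<And>k. wA k \<le> c" "\<And>k. (1 - \<delta>) * c + \<delta> * m \<le> wA k"
    and wB: "\<And>k. wB k = (1 - \<delta>) * payoff \<theta> (reward_B t r p s) (T k) + \<delta> * wB (Suc k)"
      "\<And>k. wB k \<le> c" "\<And>k. (1 - \<delta>) * c + \<delta> * m \<le> wB k"
  shows "(wA 0, wB 0) \<in> equilibrium_payoffs t r p s \<theta> \<delta>"
proof -
  let ?\<sigma> = "trigger fst T q" and ?\<tau> = "trigger snd T q"
  have c': "{s, r, p, t} \<subseteq> {0..c}" using c by simp
  have "0 \<le> (1 - \<delta>) * c + \<delta> * m" using \<delta> m by simp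
  then have abs: "\<bar>wA k\<bar> \<le> c" "\<bar>wB k\<bar> \<le> c" for k
    using wA(2,3)[of k] wB(2,3)[of k] by linarith+
  have rep: "?\<sigma> \<in> rep_strategies" "?\<tau> \<in> rep_strategies"
    using trigger_rep_strategies[of _ T, OF _ T q] by blast+
  have totA: "total_payoff \<theta> \<delta> (reward_A t r p s) ?\<sigma> ?\<tau> = \<delta> / (1 - \<delta>) * wA 0"
    by (rule total_payoff_trigger[where w = wA, OF \<delta> T q wA(1) abs(1)])
  have totB: "total_payoff \<theta> \<delta> (reward_B t r p s) ?\<sigma> ?\<tau> = \<delta> / (1 - \<delta>) * wB 0"
    by (rule total_payoff_trigger[where w = wB, OF \<delta> T q wB(1) abs(2)])
  have on_path: "stage_value \<theta> M (path T (Suc k)) = payoff \<theta> M (T k)" for M k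
    using T by (simp add: stage_value_def total_action_path(2)[OF T] del: path.simps)
  have path: "path T 0 = []" "tl (path T (Suc k)) = path T k" for k
    by simp_all
  have devA: "total_payoff \<theta> \<delta> (reward_A t r p s) \<sigma> ?\<tau> \<le> \<delta> / (1 - \<delta>) * wA 0"
    if \<sigma>: "\<sigma> \<in> rep_strategies" for \<sigma>
    unfolding total_payoff_def stage_payoff_eq[OF \<sigma> rep(2)]
  proof (rule trigger_bound[OF \<delta> stage_value_bounds[OF c] path _ wA(2) m wA(3)])
    fix k
    show "wA k = (1 - \<delta>) * stage_value \<theta> (reward_A t r p s) (path T (Suc k)) + \<delta> * wA (Suc k)"
      unfolding on_path by (rule wA(1))
    fix h assume h: "h \<in> set_pmf (play \<sigma> ?\<tau> k)" "h \<noteq> path T k"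
    show "measure_pmf.expectation (pair_pmf (\<sigma> h) (?\<tau> h))
        (\<lambda>a. stage_value \<theta> (reward_A t r p s) (a # h)) \<le> m"
      using total_action_play[OF \<sigma> rep(2) h(1)] set_pmf_play_length[OF h(1)] h(2)
      by (intro trigger_punishes_A[OF c m q punish \<sigma>]) auto
  qed
  have devB: "total_payoff \<theta> \<delta> (reward_B t r p s) ?\<sigma> \<tau> \<le> \<delta> / (1 - \<delta>) * wB 0"
    if \<tau>: "\<tau> \<in> rep_strategies" for \<tau>
    unfolding total_payoff_def stage_payoff_eq[OF rep(1) \<tau>]
  proof (rule trigger_bound[OF \<delta> _ _ path _ wB(2) m wB(3)])
    fix k
    show "wB k = (1 - \<delta>) * stage_value \<theta> (reward_B t r p s) (path T (Suc k)) + \<delta> * wB (Suc k)"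
      unfolding on_path by (rule wB(1))
    fix h assume h: "h \<in> set_pmf (play ?\<sigma> \<tau> k)" "h \<noteq> path T k"
    show "measure_pmf.expectation (pair_pmf (?\<sigma> h) (\<tau> h))
        (\<lambda>a. stage_value \<theta> (reward_B t r p s) (a # h)) \<le> m"
      using total_action_play[OF rep(1) \<tau> h(1)] set_pmf_play_length[OF h(1)] h(2)
      by (intro trigger_punishes_B[OF c m q punish \<tau>]) auto
  qed (use stage_value_bounds[OF c'] in \<open>simp_all add: reward_B_eq\<close>)
  have "nash_equilibrium t r p s \<theta> \<delta> ?\<sigma> ?\<tau>"
    unfolding nash_equilibrium_def totA totB using rep devA devB by blast
  moreover have "wA 0 = profit_per_round \<theta> \<delta> (reward_A t r p s) ?\<sigma> ?\<tau>"
    "wB 0 = profit_per_round \<theta> \<delta> (reward_B t r p s) ?\<sigma> ?\<tau>"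
    using profit_per_round_eq[OF \<delta> totA] profit_per_round_eq[OF \<delta> totB] by simp_all
  ultimately show ?thesis
    unfolding equilibrium_payoffs_def by blast
qed

text \<open>If a + b = 0, nonnegativity forces both to vanish, and division by zero yields the
  weight 0; so an edge of total weight zero needs no separate treatment later.\<close>

lemma normalized_weight:
  fixes a b :: real
  assumes "0 \<le> a" "0 \<le> b"
  shows "0 \<le> a / (a + b)" "a / (a + b) \<le> 1" "(a + b) * (a / (a + b)) = a" "(a + b) * (1 - a / (a + b)) = b"
proof -
  show "0 \<le> a / (a + b)" "a / (a + b) \<le> 1"
    using assms by (cases "a + b = 0"; simp add: divide_le_eq_1)+
  show *: "(a + b) * (a / (a + b)) = a"
    using assms by (cases "a + b = 0") auto
  show "(a + b) * (1 - a / (a + b)) = b"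
    unfolding right_diff_distrib * by simp
qed

theorem theorem3p8:
  fixes t r p s \<theta> :: real
    and \<mu> :: "(qubit_op \<times> qubit_op) measure"
  assumes "t > r" and "r > p" and "p > s" and "s \<ge> 0"
    and "0 \<le> \<theta>" and "\<theta> \<le> pi / 2"
    and "haar_prob \<mu>"
  shows "\<forall>\<epsilon>>0. \<exists>\<delta>. 0 < \<delta> \<and> \<delta> < 1 \<and>
           (\<forall>\<nu> \<in> Vstar t r p s \<theta> \<mu>.
              fst \<nu> \<ge> minimax_A t r p s \<theta> + \<epsilon> \<and> snd \<nu> \<ge> minimax_B t r p s \<theta> + \<epsilon>
              \<longrightarrow> \<nu> \<in> equilibrium_payoffs t r p s \<theta> \<delta>)"
proof (intro allI impI)
  fix \<epsilon> :: real
  assume \<epsilon>: "0 < \<epsilon>"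
  have c: "{t, r, p, s} \<subseteq> {0..t}" using assms(1-4) by auto
  have t: "0 < t" using assms(1-4) by simp
  obtain q m where q: "q \<in> mixed_strategies" and m: "0 \<le> m" "m \<le> t"
    and mlt: "m < minimax_A t r p s \<theta> + \<epsilon> / 2"
    and punish: "\<And>U. U \<in> U2 \<Longrightarrow> measure_pmf.expectation q (\<lambda>Q. payoff \<theta> (reward_A t r p s) (U, Q)) \<le> m"
    using minimax_punishment[OF c, of "\<epsilon> / 2" \<theta>] \<epsilon> by auto
  \<comment> \<open>The margin \<epsilon> is split into \<epsilon>/2 for the inexact punishment
    level, \<epsilon>/6 for the one-round gain (1 - \<delta>) t, and \<epsilon>/3 for the drift of
    the continuation values. The cap 1/2 serves the greedy sequence and gives (1 - \<delta>) /
    \<delta> \<le> 2 (1 - \<delta>).\<close>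
  define \<delta> where "\<delta> = 1 - min (1 / 2) (\<epsilon> / (6 * t))"
  have \<delta>: "1 / 2 \<le> \<delta>" "0 < \<delta>" "\<delta> < 1"
    using \<epsilon> t by (auto simp: \<delta>_def min_def)
  have "1 - \<delta> \<le> \<epsilon> / (6 * t)" by (simp add: \<delta>_def)
  then have \<delta>\<epsilon>: "(1 - \<delta>) * t \<le> \<epsilon> / 6" using t by (simp add: field_simps)
  have "(1 - \<delta>) / \<delta> \<le> (1 - \<delta>) / (1 / 2)" using \<delta> by (intro divide_left_mono) auto
  from mult_right_mono[OF this less_imp_le[OF t]] have ratio: "(1 - \<delta>) / \<delta> * t \<le> \<epsilon> / 3"
    using \<delta>\<epsilon> by (simp only: divide_divide_eq_right)
  show "\<exists>\<delta>. 0 < \<delta> \<and> \<delta> < 1 \<and> (\<forall>\<nu> \<in> Vstar t r p s \<theta> \<mu>.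
      fst \<nu> \<ge> minimax_A t r p s \<theta> + \<epsilon> \<and> snd \<nu> \<ge> minimax_B t r p s \<theta> + \<epsilon>
      \<longrightarrow> \<nu> \<in> equilibrium_payoffs t r p s \<theta> \<delta>)"
  proof (intro exI[of _ \<delta>] conjI ballI impI \<delta>)
    fix \<nu>
    assume "\<nu> \<in> Vstar t r p s \<theta> \<mu>"
      and rational: "minimax_A t r p s \<theta> + \<epsilon> \<le> fst \<nu> \<and> minimax_B t r p s \<theta> + \<epsilon> \<le> snd \<nu>"
    then have "\<nu> \<in> feasible t r p s \<theta> \<mu>" by (simp add: Vstar_def)
    then obtain y :: "move \<times> move \<Rightarrow> real" where y0: "\<And>i. 0 \<le> y i"
      and y1: "y (C, C) + y (C, D) + y (D, C) + y (D, D) = 1"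
      and \<nu>: "\<nu> = y (C, C) *\<^sub>R (r, r) + y (D, D) *\<^sub>R (p, p) + y (D, C) *\<^sub>R (t, s) + y (C, D) *\<^sub>R (s, t)"
      using feasible_convex_combination[OF assms(7)] by blast
    \<comment> \<open>Bob's classical move splits the four outcomes into two edges of the feasible polygon, and any
      point of an edge is the payoff of a single pure action pair; so \<open>\<nu>\<close> mixes just two such pairs.\<close>
    define l where "l = y (C, C) + y (D, C)"
    define \<alpha> where "\<alpha> = y (C, C) / l"
    define \<beta> where "\<beta> = y (C, D) / (1 - l)"
    have l: "0 \<le> l" "l \<le> 1" "1 - l = y (C, D) + y (D, D)"
      using y0[of "(C, C)"] y0[of "(D, C)"] y0[of "(C, D)"] y0[of "(D, D)"] y1
      by (simp_all add: l_def)
    have \<alpha>: "0 \<le> \<alpha>" "\<alpha> \<le> 1" "l * \<alpha> = y (C, C)" "l * (1 - \<alpha>) = y (D, C)"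
      unfolding \<alpha>_def l_def by (intro normalized_weight y0)+
    have \<beta>: "0 \<le> \<beta>" "\<beta> \<le> 1" "(1 - l) * \<beta> = y (C, D)" "(1 - l) * (1 - \<beta>) = y (D, D)"
      unfolding \<beta>_def l(3) by (intro normalized_weight y0)+
    obtain x b where x0: "x 0 = l" and x01: "\<And>k. x k \<in> {0..1}" and b: "\<And>k. b k \<in> {0, 1}"
      and xS: "\<And>k. x k = (1 - \<delta>) * b k + \<delta> * x (Suc k)" and xl: "\<And>k. \<bar>x k - l\<bar> \<le> (1 - \<delta>) / \<delta>"
      using greedy_discounted_sequence[OF \<delta>(1,3) l(1,2)] by blast
    define T where "T k = (if b k = (1 :: real) then (rotation \<alpha>, mat 1) else (rotation \<beta>, pauli_Y))" for k :: nat
    have T: "T k \<in> U2U2" for k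
      using rotation_U2[OF \<alpha>(1,2)] rotation_U2[OF \<beta>(1,2)] U2_pauli by (simp add: T_def)
    \<comment> \<open>Affine in the tail frequency \<open>x k\<close>, so the recursion
      \<open>xS\<close> carries over to the continuation values.\<close>
    define w where "w M k = x k * payoff \<theta> M (rotation \<alpha>, mat 1) + (1 - x k) * payoff \<theta> M (rotation \<beta>, pauli_Y)" for M k
    have wS: "w M k = (1 - \<delta>) * payoff \<theta> M (T k) + \<delta> * w M (Suc k)" for M k
    proof -
      have "payoff \<theta> M (T k) = b k * payoff \<theta> M (rotation \<alpha>, mat 1) + (1 - b k) * payoff \<theta> M (rotation \<beta>, pauli_Y)"
        using b[of k] by (auto simp: T_def)
      then show ?thesis
        by (simp only: w_def xS[of k]) (simp add: algebra_simps)
    qed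
    \<comment> \<open>Stated for arbitrary t', s' so that it serves Alice with (t, s) and Bob with
      (s, t).\<close>
    have w: "w (reward_A t' r p s') k \<le> t" "(1 - \<delta>) * t + \<delta> * m \<le> w (reward_A t' r p s') k"
      if c': "{t', r, p, s'} \<subseteq> {0..t}" and w0: "minimax_A t r p s \<theta> + \<epsilon> \<le> w (reward_A t' r p s') 0" for t' s' k
    proof -
      define u v where "u = payoff \<theta> (reward_A t' r p s') (rotation \<alpha>, mat 1)"
        and "v = payoff \<theta> (reward_A t' r p s') (rotation \<beta>, pauli_Y)"
      have "(rotation \<alpha>, mat 1) \<in> U2U2" "(rotation \<beta>, pauli_Y) \<in> U2U2"
        using rotation_U2[OF \<alpha>(1,2)] rotation_U2[OF \<beta>(1,2)] U2_pauli by auto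
      then have uv: "0 \<le> u" "u \<le> t" "0 \<le> v" "v \<le> t"
        unfolding u_def v_def using payoff_bounds[OF _ c'] by auto
      have w_eq: "w (reward_A t' r p s') k = x k * u + (1 - x k) * v" for k
        by (simp add: w_def u_def v_def)
      show "w (reward_A t' r p s') k \<le> t"
        unfolding w_eq using x01[of k] uv by (intro convex_bound_le) auto
      \<comment> \<open>The tail value has slope u - v in the frequency, and both payoffs lie in
        [0, t], so it drifts by at most t times the tolerance of the greedy sequence.\<close>
      have "\<bar>w (reward_A t' r p s') k - w (reward_A t' r p s') 0\<bar> = \<bar>x k - l\<bar> * \<bar>u - v\<bar>"
        unfolding w_eq x0 abs_mult[symmetric] by (simp add: algebra_simps)
      also have "\<dots> \<le> (1 - \<delta>) / \<delta> * t"
        using xl[of k] uv \<delta> by (intro mult_mono) auto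
      finally have "minimax_A t r p s \<theta> + \<epsilon> - \<epsilon> / 3 \<le> w (reward_A t' r p s') k"
        using ratio w0 by linarith
      moreover have "\<delta> * m \<le> m" using \<delta> m by (simp add: mult_left_le_one_le)
      ultimately show "(1 - \<delta>) * t + \<delta> * m \<le> w (reward_A t' r p s') k"
        using \<delta>\<epsilon> mlt by linarith
    qed
    have w_start: "w (reward_A t' r p s') 0 = y (C, C) * r + y (D, D) * p + y (D, C) * t' + y (C, D) * s'" for t' s'
    proof -
      have "w (reward_A t' r p s') 0 = (l * \<alpha>) * r + (l * (1 - \<alpha>)) * t' + ((1 - l) * \<beta>) * s' + ((1 - l) * (1 - \<beta>)) * p"
        unfolding w_def x0 payoff_rotation[OF \<alpha>(1,2)] payoff_rotation[OF \<beta>(1,2)]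
        by (simp add: algebra_simps)
      then show ?thesis
        unfolding \<alpha>(3,4) \<beta>(3,4) by simp
    qed
    have \<nu>_eq: "\<nu> = (w (reward_A t r p s) 0, w (reward_B t r p s) 0)"
      unfolding reward_B_eq w_start \<nu> by simp
    have "{s, r, p, t} \<subseteq> {0..t}" using c by simp
    then show "\<nu> \<in> equilibrium_payoffs t r p s \<theta> \<delta>"
      unfolding \<nu>_eq using rational w[of t s] w[of s t] c
      by (intro trigger_equilibrium[where T = T, OF c \<delta>(2,3) T m q punish wS _ _ wS])
         (simp_all add: \<nu>_eq minimax_B_eq reward_B_eq)
  qed
qed

end
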